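(* Let $\hat\alpha$ be any automorphism of $\hat{\mathcal X}$ and put $\varphi:=\varphi_0\circ\hat\alpha$. Then the map $S\mapsto\varphi(S)$ induces: (a) a bijection from the set of centric hexagons of $\hat{\mathcal X}$ with center $n_0$ onto the set of non-linear $3$-cliques of $\Gamma$; (b) a bijection from the set of centric cubes of $\hat{\mathcal X}$ with center $n_0$ onto the set of non-linear $4$-cliques of $\Gamma$; (c) a bijection from the set of centric dodecades of $\hat{\mathcal X}$ with center $n_0$ onto the set of non-linear $6$-cliques of $\Gamma$.
   Context: Let $q=2^n$, $V=V(6,q)$, and let $Q=Q^-(5,q)$ be the set of singular points of a non-degenerate quadratic form $f$ of Witt index $2$ on $V$, a generalized quadrangle of order $(q,q^2)$ whose lines are the totally singular lines; $\perp$ is the polarity defined by the bilinear form of $f$. Let $H_0$ be a hyperplane with $Q_0:=Q\cap H_0\cong Q(4,q)$ parabolic, and $n_0:=H_0^\perp$ (nucleus of $Q_0$, not on $Q$). An elliptic ovoid of $Q_0$ is $S\cap Q_0$ for a $3$-dimensional subspace $S$ of $H_0$ meeting $Q_0$ in an elliptic quadric; two distinct elliptic ovoids are tangent if they meet in exactly one point. A rosette based at $p\in Q_0$ is a set of $q$ elliptic ovoids pairwise meeting exactly in $\{p\}$. $\Gamma$: vertices the elliptic ovoids, adjacency = tangency; a clique is linear if contained in a rosette, non-linear otherwise. $\hat{\mathcal X}$ is the geometry with points $Q\setminus Q_0$ and lines $\hat l=l\setminus\{l\cap Q_0\}$ for lines $l$ of $Q$ not contained in $Q_0$; $\hat\Gamma$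 is its collinearity graph. $\varphi_0$ is the map $x\mapsto x^\perp\cap Q_0$ on points of $\hat{\mathcal X}$ (a $2$-fold covering of $\mathcal X$, the geometry of elliptic ovoids and rosettes). For $k\ge3$, a centric $2k$-configuration of $\hat{\mathcal X}$ with center $n_0$ is a set of $2k$ points $\{x_i^a: i=1,\dots,k,\ a=1,2\}$ of $Q\setminus Q_0$ such that $x_i^a$ and $x_j^b$ are adjacent in $\hat\Gamma$ iff $i\ne j$ and $a\ne b$, and for each $i$ the projective line through $x_i^1,x_i^2$ passes through $n_0$. It is called a centric hexagon, cube, decade, dodecade for $k=3,4,5,6$ respectively. *)

theory Defs
  imports "HOL-Analysis.Analysis"
begin

text \<open>Ambient space V = V(6,q): the vector space 'F^6 over a finite field 'F,
  with scalar multiplication (*s).  Linear algebra (subspace, span, dim) is that of the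
  library interpretation vec of vector_space (*s).
  A projective point is a 1-dimensional subspace, represented as a set of vectors.\<close>

type_synonym 'a pt = "('a ^ 6) set"

definition polar :: "('a::field ^ 6 \<Rightarrow> 'a) \<Rightarrow> 'a ^ 6 \<Rightarrow> 'a ^ 6 \<Rightarrow> 'a" where
  "polar f u v = f (u + v) - f u - f v"

definition quadratic_form :: "('a::field ^ 6 \<Rightarrow> 'a) \<Rightarrow> bool" where
  "quadratic_form f \<longleftrightarrow>
     (\<forall>c v. f (c *s v) = c ^ 2 * f v) \<and>
     (\<forall>u v w. polar f (u + v) w = polar f u w + polar f v w) \<and>
     (\<forall>c u w. polar f (c *s u) w = c * polar f u w)"

definition nondeg_on :: "('a::field ^ 6 \<Rightarrow> 'a) \<Rightarrow> ('a ^ 6) set \<Rightarrow> bool" where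
  "nondeg_on f W \<longleftrightarrow>
     (\<forall>x\<in>W. f x = 0 \<and> (\<forall>y\<in>W. polar f x y = 0) \<longrightarrow> x = 0)"

definition totally_singular :: "('a::field ^ 6 \<Rightarrow> 'a) \<Rightarrow> ('a ^ 6) set \<Rightarrow> bool" where
  "totally_singular f U \<longleftrightarrow> vec.subspace U \<and> (\<forall>x\<in>U. f x = 0)"

definition witt_index_on :: "('a::field ^ 6 \<Rightarrow> 'a) \<Rightarrow> ('a ^ 6) set \<Rightarrow> nat \<Rightarrow> bool" where
  "witt_index_on f W k \<longleftrightarrow>
     (\<exists>U. U \<subseteq> W \<and> totally_singular f U \<and> vec.dim U = k) \<and>
     (\<forall>U. U \<subseteq> W \<and> totally_singular f U \<longrightarrow> vec.dim U \<le> k)"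

definition Qpts :: "('a::field ^ 6 \<Rightarrow> 'a) \<Rightarrow> 'a pt set" where
  "Qpts f = {vec.span {v} | v. v \<noteq> 0 \<and> f v = 0}"

definition Q0pts :: "('a::field ^ 6 \<Rightarrow> 'a) \<Rightarrow> ('a ^ 6) set \<Rightarrow> 'a pt set" where
  "Q0pts f H0 = {p \<in> Qpts f. p \<subseteq> H0}"

definition Qlines :: "('a::field ^ 6 \<Rightarrow> 'a) \<Rightarrow> ('a ^ 6) set set" where
  "Qlines f = {l. totally_singular f l \<and> vec.dim l = 2}"

definition perp :: "('a::field ^ 6 \<Rightarrow> 'a) \<Rightarrow> ('a ^ 6) set \<Rightarrow> ('a ^ 6) set" where
  "perp f X = {y. \<forall>x\<in>X. polar f x y = 0}"

definition nucleus :: "('a::field ^ 6 \<Rightarrow> 'a) \<Rightarrow> ('a ^ 6) set \<Rightarrow> 'a pt" where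
  "nucleus f H0 = perp f H0"

text \<open>Elliptic ovoids of Q_0: S \<inter> Q_0 for a projective 3-space S (vector dim 4) of H_0 meeting
  Q in an elliptic quadric Q^-(3,q) (non-degenerate of Witt index 1).\<close>
definition elliptic_ovoids :: "('a::field ^ 6 \<Rightarrow> 'a) \<Rightarrow> ('a ^ 6) set \<Rightarrow> 'a pt set set" where
  "elliptic_ovoids f H0 =
     {{p \<in> Q0pts f H0. p \<subseteq> S} | S. vec.subspace S \<and> S \<subseteq> H0 \<and> vec.dim S = 4 \<and>
         nondeg_on f S \<and> witt_index_on f S 1}"

definition tangent :: "'a pt set \<Rightarrow> 'a pt set \<Rightarrow> bool" where
  "tangent O1 O2 \<longleftrightarrow> O1 \<noteq> O2 \<and> card (O1 \<inter> O2) = 1"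

definition rosette :: "('a::{field,finite} ^ 6 \<Rightarrow> 'a) \<Rightarrow> ('a ^ 6) set \<Rightarrow> 'a pt \<Rightarrow> 'a pt set set \<Rightarrow> bool" where
  "rosette f H0 p R \<longleftrightarrow> p \<in> Q0pts f H0 \<and> R \<subseteq> elliptic_ovoids f H0 \<and> card R = CARD('a) \<and>
     (\<forall>O1\<in>R. \<forall>O2\<in>R. O1 \<noteq> O2 \<longrightarrow> O1 \<inter> O2 = {p})"

definition Gamma_cliques :: "('a::field ^ 6 \<Rightarrow> 'a) \<Rightarrow> ('a ^ 6) set \<Rightarrow> nat \<Rightarrow> 'a pt set set set" where
  "Gamma_cliques f H0 k = {K. K \<subseteq> elliptic_ovoids f H0 \<and> card K = k \<and>
     (\<forall>O1\<in>K. \<forall>O2\<in>K. O1 \<noteq> O2 \<longrightarrow> tangent O1 O2)}"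

definition linear_clique :: "('a::{field,finite} ^ 6 \<Rightarrow> 'a) \<Rightarrow> ('a ^ 6) set \<Rightarrow> 'a pt set set \<Rightarrow> bool" where
  "linear_clique f H0 K \<longleftrightarrow> (\<exists>p R. rosette f H0 p R \<and> K \<subseteq> R)"

definition nonlinear_cliques :: "('a::{field,finite} ^ 6 \<Rightarrow> 'a) \<Rightarrow> ('a ^ 6) set \<Rightarrow> nat \<Rightarrow> 'a pt set set set" where
  "nonlinear_cliques f H0 k = {K \<in> Gamma_cliques f H0 k. \<not> linear_clique f H0 K}"

definition Xpts :: "('a::field ^ 6 \<Rightarrow> 'a) \<Rightarrow> ('a ^ 6) set \<Rightarrow> 'a pt set" where
  "Xpts f H0 = Qpts f - Q0pts f H0"

definition Xlines :: "('a::field ^ 6 \<Rightarrow> 'a) \<Rightarrow> ('a ^ 6) set \<Rightarrow> 'a pt set set" where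
  "Xlines f H0 = {{p \<in> Qpts f. p \<subseteq> l} - Q0pts f H0 | l. l \<in> Qlines f \<and> \<not> l \<subseteq> H0}"

definition Xadj :: "('a::field ^ 6 \<Rightarrow> 'a) \<Rightarrow> ('a ^ 6) set \<Rightarrow> 'a pt \<Rightarrow> 'a pt \<Rightarrow> bool" where
  "Xadj f H0 x y \<longleftrightarrow> x \<noteq> y \<and> (\<exists>L\<in>Xlines f H0. x \<in> L \<and> y \<in> L)"

definition X_automorphism :: "('a::field ^ 6 \<Rightarrow> 'a) \<Rightarrow> ('a ^ 6) set \<Rightarrow> ('a pt \<Rightarrow> 'a pt) \<Rightarrow> bool" where
  "X_automorphism f H0 \<alpha> \<longleftrightarrow> bij_betw \<alpha> (Xpts f H0) (Xpts f H0) \<and>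
     (\<forall>L. L \<subseteq> Xpts f H0 \<longrightarrow> (L \<in> Xlines f H0 \<longleftrightarrow> \<alpha> ` L \<in> Xlines f H0))"

definition phi0 :: "('a::field ^ 6 \<Rightarrow> 'a) \<Rightarrow> ('a ^ 6) set \<Rightarrow> 'a pt \<Rightarrow> 'a pt set" where
  "phi0 f H0 x = {p \<in> Q0pts f H0. p \<subseteq> perp f x}"

definition centric_configs :: "('a::field ^ 6 \<Rightarrow> 'a) \<Rightarrow> ('a ^ 6) set \<Rightarrow> nat \<Rightarrow> 'a pt set set" where
  "centric_configs f H0 k = {C. \<exists>x :: nat \<Rightarrow> nat \<Rightarrow> 'a pt.
      inj_on (\<lambda>(i, a). x i a) ({1..k} \<times> {1, 2}) \<and>
      C = (\<lambda>(i, a). x i a) ` ({1..k} \<times> {1, 2}) \<and>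
      (\<forall>i\<in>{1..k}. \<forall>a\<in>{1,2}. x i a \<in> Xpts f H0) \<and>
      (\<forall>i\<in>{1..k}. \<forall>a\<in>{1,2}. \<forall>j\<in>{1..k}. \<forall>b\<in>{1,2}.
          Xadj f H0 (x i a) (x j b) \<longleftrightarrow> i \<noteq> j \<and> a \<noteq> b) \<and>
      (\<forall>i\<in>{1..k}. nucleus f H0 \<subseteq> vec.span (x i 1 \<union> x i 2))}"

end

theory Submission
  imports Defs
begin

text \<open>Let \<open>n\<close> span the nucleus with \<open>f n = 1\<close>. The points of \<open>Q\<close> off \<open>H\<^sub>0\<close> are represented by the
  singular vectors \<open>x\<close> with \<open>B x n = 1\<close>, and the fibre of \<open>\<phi>\<^sub>0\<close> through \<open>x\<close> is \<open>{x, x + n}\<close>; here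
  \<open>B x (y + n) = B x y + 1\<close>. Two points are collinear iff \<open>B x y = 0\<close>, and their ovoids are tangent
  iff they lie in different fibres and \<open>B x y \<in> {0, 1}\<close>. Centric configurations are therefore the
  full preimages of sets on which \<open>B\<close> is constantly 1. A clique containing a triple that lifts to three
  collinear points lies entirely on that line, hence in a rosette; every other clique lifts to
  a set with \<open>B = 1\<close> throughout. This gives the bijection for \<open>\<phi>\<^sub>0\<close> and every \<open>k \<ge> 3\<close>. Finally
  an automorphism permutes the centric configurations, because antipodality
  \<open>x \<mapsto> x + n\<close> can be read off from the collinearity graph.\<close>

section \<open>Forms in characteristic 2\<close>

text \<open>Translation by 1 permutes the field, so the sum of all elements equals itself plus
  \<open>CARD('a)\<close> copies of 1. Hence a power of 2 vanishes in the field, and so does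
  2.\<close>

lemma two_eq_0_if_card_power_2:
  assumes "CARD('a::{field,finite}) = 2 ^ n"
  shows "(1::'a) + 1 = 0"
proof -
  have "(\<Sum>x\<in>UNIV. x + 1) = (\<Sum>x\<in>UNIV. x :: 'a)"
    by (rule sum.reindex_bij_witness[of _ "\<lambda>x. x - 1" "\<lambda>x. x + 1"]) auto
  then have "of_nat CARD('a) = (0::'a)" by (simp add: sum.distrib)
  then show ?thesis by (simp add: assms)
qed

locale char2_form =
  fixes f :: "'a::{field,finite} ^ 6 \<Rightarrow> 'a"
  assumes two: "(1::'a) + 1 = 0"
    and qf: "quadratic_form f"
begin

abbreviation B where "B \<equiv> polar f"

lemma add_self: "x + x = (0::'a)"
  by (metis distrib_left mult.right_neutral mult_zero_right two)

lemma add_self_left: "x + (x + y) = (y::'a)"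
  by (simp add: add.assoc [symmetric] add_self)

lemma two_eq_0: "(2::'a) = 0"
  using two by simp

lemma neg_eq: "- x = (x::'a)"
  by (simp add: neg_eq_iff_add_eq_0 add_self)

lemma diff_eq: "x - y = x + (y::'a)"
  by (metis diff_conv_add_uminus neg_eq)

lemma add_eq_0: "x + y = 0 \<longleftrightarrow> x = (y::'a)"
  by (metis add_self add_self_left add.right_neutral)

lemma vadd_self: "x + x = (0::'a ^ 6)"
  unfolding vec_eq_iff by (simp only: vector_add_component add_self zero_index simp_thms)

lemma vadd_self_left: "x + (x + y) = (y::'a ^ 6)"
  by (simp add: add.assoc [symmetric] vadd_self)

lemma vadd_eq_0: "x + y = 0 \<longleftrightarrow> x = (y::'a ^ 6)"
  by (metis vadd_self vadd_self_left add.right_neutral)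

lemma f_scale: "f (c *s v) = c ^ 2 * f v"
  using qf by (simp add: quadratic_form_def)

lemma f_0 [simp]: "f 0 = 0"
  using f_scale[of 0 0] by simp

lemma f_add: "f (u + v) = f u + f v + B u v"
  by (simp add: polar_def)

lemma B_sym: "B u v = B v u"
  by (simp add: polar_def add.commute)

lemma B_add_left: "B (u + v) w = B u w + B v w"
  using qf unfolding quadratic_form_def by blast

lemma B_scale_left: "B (c *s u) w = c * B u w"
  using qf unfolding quadratic_form_def by blast

lemma B_add_right: "B w (u + v) = B w u + B w v"
  by (metis B_add_left B_sym)

lemma B_scale_right: "B w (c *s u) = c * B w u"
  by (metis B_scale_left B_sym)

lemma B_self [simp]: "B u u = 0"
  by (simp add: polar_def vadd_self diff_eq add_self)

lemma B_0_left [simp]: "B 0 u = 0"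
  using B_scale_left[of 0 0 u] by simp

lemma B_0_right [simp]: "B u 0 = 0"
  using B_sym[of u 0] by simp

lemmas form_simps = B_add_left B_add_right B_scale_left B_scale_right f_add f_scale
  add_self add_self_left power2_eq_square

text \<open>Squaring is additive in characteristic 2 with trivial kernel, hence injective, and on a
  finite field therefore surjective.\<close>

lemma square_root: obtains c where "c ^ 2 = (a::'a)"
proof -
  have "inj (\<lambda>c::'a. c ^ 2)"
  proof (rule injI)
    fix x y :: 'a assume "x ^ 2 = y ^ 2"
    then have "(x + y) ^ 2 = 0" by (simp add: power2_eq_square algebra_simps add_self add_self_left)
    then show "x = y" by (simp add: add_eq_0)
  qed
  then have "surj (\<lambda>c::'a. c ^ 2)" by (simp add: finite_UNIV_inj_surj)
  then show thesis using that by (metis surjD)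
qed

lemma scale_to_1:
  assumes "f v \<noteq> 0"
  obtains c where "c \<noteq> 0" "f (c *s v) = 1"
proof -
  obtain c where c: "c ^ 2 = inverse (f v)" using square_root by blast
  with assms have "c \<noteq> 0" by auto
  moreover have "f (c *s v) = 1" using assms c by (simp add: f_scale)
  ultimately show thesis by (rule that)
qed

section \<open>Orthogonal complements, hyperbolic pairs and radicals\<close>

lemma subspace_perp: "vec.subspace (perp f X)"
  unfolding vec.subspace_def perp_def by (auto simp: form_simps)

lemma subspace_ortho: "vec.subspace {w. B u w = 0}"
  unfolding vec.subspace_def by (auto simp: form_simps)

lemma perp_span: "perp f (vec.span X) = perp f X"
proof
  show "perp f (vec.span X) \<subseteq> perp f X"
    unfolding perp_def using vec.span_superset by blast
  show "perp f X \<subseteq> perp f (vec.span X)"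
  proof
    fix y assume "y \<in> perp f X"
    then have "X \<subseteq> {w. B y w = 0}" by (auto simp: perp_def B_sym)
    then have "vec.span X \<subseteq> {w. B y w = 0}" by (rule vec.span_minimal) (rule subspace_ortho)
    then show "y \<in> perp f (vec.span X)" by (auto simp: perp_def B_sym)
  qed
qed

text \<open>Removes the component of \<open>w\<close> in the hyperbolic plane of \<open>u\<close>
  and \<open>v\<close>; in characteristic 2 subtracting it is the same as adding it.\<close>

lemma hyperbolic_decomp:
  assumes "B u v = 1"
  shows "w + (B w v *s u + B w u *s v) \<in> perp f {u, v}"
  using assms by (auto simp: perp_def form_simps B_sym)

text \<open>\<open>W\<close> is the direct sum of the hyperbolic plane and its complement in
  \<open>W\<close>: \<open>hyperbolic_decomp\<close> shows that they span, and
  \<open>B u v = 1\<close> gives independence.\<close>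

lemma dim_hyperbolic:
  assumes W: "vec.subspace W" and uv: "u \<in> W" "v \<in> W" "B u v = 1"
  shows "vec.dim W = vec.dim (W \<inter> perp f {u, v}) + 2"
proof -
  let ?W = "W \<inter> perp f {u, v}"
  have sub: "vec.subspace ?W" using W subspace_perp by (rule vec.subspace_inter)
  have "vec.span (insert u (insert v ?W)) = W"
  proof
    show "vec.span (insert u (insert v ?W)) \<subseteq> W"
      by (rule vec.span_minimal) (use W uv in auto)
    show "W \<subseteq> vec.span (insert u (insert v ?W))"
    proof
      fix w assume w: "w \<in> W"
      let ?c = "B w v *s u + B w u *s v"
      have "w + ?c \<in> ?W"
        using hyperbolic_decomp[OF uv(3)] w uv(1,2) W by (simp add: vec.subspace_add vec.subspace_scale)
      then have "(w + ?c) + ?c \<in> vec.span (insert u (insert v ?W))"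
        by (intro vec.span_add vec.span_scale vec.span_base) auto
      then show "w \<in> vec.span (insert u (insert v ?W))"
        by (simp only: add.assoc vadd_self add.right_neutral)
    qed
  qed
  then have "vec.dim W = vec.dim (insert u (insert v ?W))" by (metis vec.dim_span)
  moreover have "v \<notin> vec.span ?W"
    using uv(3) sub by (auto simp: vec.span_eq_iff[THEN iffD2] perp_def)
  moreover have "vec.span (insert v ?W) \<subseteq> {w. B v w = 0}"
    by (rule vec.span_minimal) (auto simp: subspace_ortho perp_def)
  then have "u \<notin> vec.span (insert v ?W)"
    using uv(3) by (auto simp: B_sym)
  ultimately show ?thesis by (simp add: vec.dim_insert)
qed

lemma hyperbolic_pair:
  assumes "vec.subspace W" "u \<in> W" "w \<in> W" "B u w \<noteq> 0"
  obtains v where "v \<in> W" "B u v = 1"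
proof
  show "inverse (B u w) *s w \<in> W" using assms by (simp add: vec.subspace_scale)
  show "B u (inverse (B u w) *s w) = 1" using assms by (simp add: form_simps)
qed

text \<open>Carries orthogonality from the complement of a hyperbolic plane back to all of
  \<open>W\<close>; this is what lets the inductions on dimension pass through
  \<open>dim_hyperbolic\<close>.\<close>

lemma radical_hyperbolic:
  assumes "B u v = 1" "vec.subspace W" "u \<in> W" "v \<in> W"
    and r: "r \<in> perp f {u, v}" "\<And>w. w \<in> W \<inter> perp f {u, v} \<Longrightarrow> B r w = 0"
    and w: "w \<in> W"
  shows "B r w = 0"
proof -
  have "w + (B w v *s u + B w u *s v) \<in> W \<inter> perp f {u, v}"
    using assms hyperbolic_decomp by (simp add: vec.subspace_add vec.subspace_scale)
  from r(2)[OF this] show ?thesis using r(1) by (simp add: form_simps perp_def B_sym)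
qed

text \<open>An alternating form has even rank. Splitting off hyperbolic planes lowers the dimension
  by 2 and keeps it odd, until a nonzero space with vanishing form remains.\<close>

lemma odd_dim_radical:
  assumes "vec.subspace W" "odd (vec.dim W)"
  shows "\<exists>r\<in>W. r \<noteq> 0 \<and> (\<forall>w\<in>W. B r w = 0)"
  using assms
proof (induction "vec.dim W" arbitrary: W rule: less_induct)
  case less
  show ?case
  proof (cases "\<forall>u\<in>W. \<forall>w\<in>W. B u w = 0")
    case True
    have "\<not> W \<subseteq> {0}" using less.prems(2) by (metis vec.dim_eq_0 even_zero)
    then show ?thesis using True by auto
  next
    case False
    then obtain u w where uw: "u \<in> W" "w \<in> W" "B u w \<noteq> 0" by blast
    obtain v where v: "v \<in> W" "B u v = 1" using hyperbolic_pair[OF less.prems(1) uw] by blast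
    let ?W = "W \<inter> perp f {u, v}"
    have d: "vec.dim W = vec.dim ?W + 2" by (rule dim_hyperbolic) (use less.prems uw v in auto)
    have "vec.subspace ?W" using less.prems(1) subspace_perp by (rule vec.subspace_inter)
    with less.hyps[of ?W] less.prems d
    obtain r where r: "r \<in> ?W" "r \<noteq> 0" "\<And>w. w \<in> ?W \<Longrightarrow> B r w = 0" by auto
    have "B r w = 0" if "w \<in> W" for w
      using radical_hyperbolic[OF v(2) less.prems(1) uw(1) v(1) _ r(3) that] r(1) by blast
    with r show ?thesis by blast
  qed
qed

text \<open>In characteristic 2 a form that is nondegenerate in the weak sense may still have a
  one-dimensional polar radical (the nucleus); parity of the dimension excludes this.\<close>

lemma even_dim_nondegenerate:
  assumes "vec.subspace W" "even (vec.dim W)" "nondeg_on f W"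
    and "r \<in> W" "\<And>w. w \<in> W \<Longrightarrow> B r w = 0"
  shows "r = 0"
  using assms
proof (induction "vec.dim W" arbitrary: W rule: less_induct)
  case less
  show ?case
  proof (cases "\<forall>u\<in>W. \<forall>w\<in>W. B u w = 0")
    case True
    show ?thesis
    proof (rule ccontr)
      assume r: "r \<noteq> 0"
      have aniso: "w = 0" if "w \<in> W" "f w = 0" for w
        using less.prems(3) True that by (auto simp: nondeg_on_def)
      have fr: "f r \<noteq> 0" using aniso r less.prems(4) by blast
      \<comment> \<open>With \<open>B\<close> zero on \<open>W\<close>, the form is additive there,
        and square roots make every \<open>w\<close> singular after adding a multiple of
        \<open>r\<close>. Anisotropy then leaves only a line, of odd dimension.\<close>
      have "W \<subseteq> vec.span {r}"
      proof
        fix w assume w: "w \<in> W"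
        obtain c where c: "c ^ 2 = f w / f r" using square_root by blast
        have "f (w + c *s r) = 0"
          using c fr True w less.prems(4) by (simp add: f_add f_scale B_scale_right add_self)
        then have "w + c *s r = 0"
          using aniso w less.prems(1,4) by (simp add: vec.subspace_add vec.subspace_scale)
        then show "w \<in> vec.span {r}" by (auto simp: vadd_eq_0 vec.span_singleton)
      qed
      moreover have "vec.span {r} \<subseteq> W" by (rule vec.span_minimal) (use less.prems in auto)
      ultimately have "vec.dim W = vec.dim {r}" by (metis vec.dim_span subset_antisym)
      then show False using r less.prems(2) by simp
    qed
  next
    case False
    then obtain u w where uw: "u \<in> W" "w \<in> W" "B u w \<noteq> 0" by blast
    obtain v where v: "v \<in> W" "B u v = 1" using hyperbolic_pair[OF less.prems(1) uw] by blast
    let ?W = "W \<inter> perp f {u, v}"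
    have d: "vec.dim W = vec.dim ?W + 2" by (rule dim_hyperbolic) (use less.prems uw v in auto)
    have "vec.subspace ?W" using less.prems(1) subspace_perp by (rule vec.subspace_inter)
    moreover have "nondeg_on f ?W"
      unfolding nondeg_on_def
    proof (intro ballI impI)
      fix x assume x: "x \<in> ?W" "f x = 0 \<and> (\<forall>y\<in>?W. B x y = 0)"
      then have "\<forall>w\<in>W. B x w = 0"
        using radical_hyperbolic[OF v(2) less.prems(1) uw(1) v(1)] by blast
      with x show "x = 0" using less.prems(3) by (auto simp: nondeg_on_def)
    qed
    moreover have "r \<in> ?W" using less.prems(4,5) uw(1) v(1) B_sym[of _ r] by (auto simp: perp_def)
    ultimately show ?thesis using less.hyps[of ?W] less.prems d by auto
  qed
qed

end

section \<open>The nucleus and the affine points\<close>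

text \<open>Odd dimension gives \<open>H0\<close> a radical vector, nonsingular because the section
  is parabolic, and a square root scales it to \<open>f n = 1\<close>. Comparing dimensions
  identifies \<open>H0\<close> with the complement of \<open>n\<close>.\<close>

lemma (in char2_form) nucleus_vector:
  assumes nd: "\<And>r. (\<And>w. B r w = 0) \<Longrightarrow> r = 0"
    and H0: "vec.subspace H0" "vec.dim H0 = 5" and parabolic: "nondeg_on f H0"
  obtains n where "f n = 1" "H0 = {w. B n w = 0}" "nucleus f H0 = vec.span {n}"
proof -
  obtain r where r: "r \<in> H0" "r \<noteq> 0" "\<And>w. w \<in> H0 \<Longrightarrow> B r w = 0"
    using odd_dim_radical[OF H0(1)] H0(2) by auto
  then have "f r \<noteq> 0" using parabolic by (auto simp: nondeg_on_def)
  then obtain c where c: "c \<noteq> 0" "f (c *s r) = 1" by (rule scale_to_1)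
  define n where "n = c *s r"
  have fn: "f n = 1" using c by (simp add: n_def)
  then have "n \<noteq> 0" by auto
  then obtain m where m: "B n m \<noteq> 0" using nd by blast
  have sub: "H0 \<subseteq> {w. B n w = 0}" using r(3) by (auto simp: n_def form_simps)
  have "H0 = {w. B n w = 0}"
  proof (rule vec.subspace_dim_equal[OF H0(1) subspace_ortho sub])
    have "m \<notin> vec.span {w. B n w = 0}"
      using m vec.span_minimal[OF subset_refl subspace_ortho, of n] by blast
    then have "vec.dim {w. B n w = 0} + 1 = vec.dim (insert m {w. B n w = 0})"
      by (simp add: vec.dim_insert)
    also have "\<dots> \<le> 6" using vec.dim_subset_UNIV[of "insert m {w. B n w = 0}"]
      by (simp add: vec.dimension_def card_cart_basis)
    finally show "vec.dim {w. B n w = 0} \<le> vec.dim H0" using H0 by simp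
  qed
  moreover have "nucleus f H0 = vec.span {n}"
  proof
    show "vec.span {n} \<subseteq> nucleus f H0"
      unfolding nucleus_def
      by (rule vec.span_minimal[OF _ subspace_perp]) (use sub in \<open>auto simp: perp_def B_sym\<close>)
    show "nucleus f H0 \<subseteq> vec.span {n}"
    proof
      fix y assume y: "y \<in> nucleus f H0"
      \<comment> \<open>Chosen so that \<open>y + d *s n\<close> is also orthogonal to
        \<open>m\<close>. Since \<open>m\<close> and \<open>H0\<close> together span the space, this
        vector lies in the radical of \<open>B\<close> and is 0.\<close>
      define d where "d = B y m / B n m"
      have "B (y + d *s n) w = 0" for w
      proof -
        have "w + (B n w / B n m) *s m \<in> H0"
          using m by (simp add: \<open>H0 = _\<close> form_simps)
        then have "B y (w + (B n w / B n m) *s m) = 0"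
          using y by (auto simp: nucleus_def perp_def B_sym)
        then have "B y w = B n w / B n m * B y m" by (simp add: form_simps add_eq_0)
        then show ?thesis by (simp add: form_simps d_def mult.commute)
      qed
      then have "y = d *s n" using nd by (metis vadd_eq_0)
      then show "y \<in> vec.span {n}" by (auto simp: vec.span_singleton)
    qed
  qed
  ultimately show thesis using fn that by blast
qed

locale nucleus_form = char2_form +
  fixes H0 :: "('a ^ 6) set" and n :: "'a ^ 6"
  assumes nd: "\<And>r. (\<And>w. B r w = 0) \<Longrightarrow> r = 0"
    and witt: "witt_index_on f UNIV 2"
    and f_n [simp]: "f n = 1"
    and H0_eq: "H0 = {w. B n w = 0}"
    and nucleus_eq: "nucleus f H0 = vec.span {n}"
begin

lemma totally_singular_span:
  assumes "\<And>x. x \<in> X \<Longrightarrow> f x = 0" "\<And>x y. x \<in> X \<Longrightarrow> y \<in> X \<Longrightarrow> B x y = 0"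
  shows "totally_singular f (vec.span X)"
proof -
  have 1: "y \<in> vec.span X \<Longrightarrow> x \<in> X \<Longrightarrow> B x y = 0" for x y
    using vec.span_minimal[of X "{w. B x w = 0}"] assms subspace_ortho by blast
  have "x \<in> vec.span X \<and> f x = 0" if "x \<in> vec.span X" for x
    using that
  proof (induction rule: vec.span_induct_alt)
    case (step c x y)
    then show ?case using 1[of y x] assms
      by (simp add: form_simps vec.span_add vec.span_scale vec.span_base)
  qed (simp add: vec.span_zero)
  then show ?thesis by (simp add: totally_singular_def)
qed

lemma witt_le_2: "totally_singular f U \<Longrightarrow> vec.dim U \<le> 2"
  using witt by (simp add: witt_index_on_def)

text \<open>Otherwise the three vectors would span a totally singular 3-space, against Witt index 2.
  Geometrically, the quadrangle has no triangles.\<close>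

lemma singular_dependent:
  assumes "f x = 0" "f y = 0" "f z = 0" "B x y = 0" "B x z = 0" "B y z = 0"
    and "x \<noteq> 0" "y \<notin> vec.span {x}"
  shows "z \<in> vec.span {x, y}"
proof (rule ccontr)
  assume "z \<notin> vec.span {x, y}"
  then have "z \<notin> vec.span {y, x}" by (simp add: insert_commute)
  then have "vec.dim (vec.span {z, y, x}) = 3"
    using assms by (simp add: vec.dim_insert)
  moreover have "totally_singular f (vec.span {z, y, x})"
    by (rule totally_singular_span) (use assms B_sym in auto)
  ultimately show False using witt_le_2 by fastforce
qed

lemma in_span_pair: "z \<in> vec.span {x, y} \<longleftrightarrow> (\<exists>a b. z = a *s x + b *s (y :: 'a ^ 6))"
proof -
  have "z \<in> vec.span {x, y} \<longleftrightarrow> (\<exists>a b. z - a *s x = b *s y)"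
    by (auto simp: vec.span_insert vec.span_singleton)
  then show ?thesis by (simp add: diff_eq_eq add.commute)
qed

section \<open>Normalized vectors for the points off \<open>H0\<close>\<close>

definition A where "A = {x. f x = 0 \<and> B x n = 1}"

abbreviation pt :: "'a ^ 6 \<Rightarrow> 'a pt" where "pt x \<equiv> vec.span {x}"

definition ov where "ov x = phi0 f H0 (pt x)"

lemma B_n_left: "B n x = B x n" by (rule B_sym)

lemma A_antipode: "x \<in> A \<Longrightarrow> x + n \<in> A"
  by (simp add: A_def form_simps)

lemma A_B_antipode: "x \<in> A \<Longrightarrow> y \<in> A \<Longrightarrow> B x (y + n) = B x y + 1"
  by (simp add: A_def form_simps)

lemma A_B_antipode_left: "x \<in> A \<Longrightarrow> y \<in> A \<Longrightarrow> B (x + n) y = B x y + 1"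
  by (simp add: A_def form_simps B_n_left)

lemma n_nonzero: "n \<noteq> 0" using f_n by force

lemma A_nonzero: "x \<in> A \<Longrightarrow> x \<noteq> 0" by (auto simp: A_def)

lemma pt_eqD:
  assumes "pt x = pt y" "x \<in> A" "y \<in> A"
  shows "x = y"
proof -
  have "x \<in> pt y" using assms(1) vec.span_base by blast
  then obtain c where "x = c *s y" by (auto simp: vec.span_singleton)
  with assms(2,3) show ?thesis by (auto simp: A_def form_simps)
qed

lemma pt_scale: "c \<noteq> 0 \<Longrightarrow> pt (c *s x) = pt (x :: 'a ^ 6)"
  using vec.span_image_scale[of "{x}" "\<lambda>_. c"] by simp

lemma span_subset_subspace: "vec.subspace S \<Longrightarrow> vec.span X \<subseteq> S \<longleftrightarrow> X \<subseteq> S"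
  by (meson vec.span_minimal vec.span_superset order_trans)

lemma subspace_H0: "vec.subspace H0"
  unfolding H0_eq by (rule subspace_ortho)

lemma pt_subset_H0: "pt v \<subseteq> H0 \<longleftrightarrow> B v n = 0"
  by (simp add: span_subset_subspace subspace_H0 H0_eq[symmetric]) (simp add: H0_eq B_n_left)

lemma Q0pts_eq: "Q0pts f H0 = pt ` {v. v \<noteq> 0 \<and> f v = 0 \<and> B v n = 0}"
proof -
  have "Q0pts f H0 = {pt v | v. v \<noteq> 0 \<and> f v = 0 \<and> pt v \<subseteq> H0}"
    unfolding Q0pts_def Qpts_def by blast
  then show ?thesis by (simp only: pt_subset_H0 setcompr_eq_image)
qed

lemma Xpts_eq: "Xpts f H0 = pt ` A"
proof
  show "Xpts f H0 \<subseteq> pt ` A"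
  proof
    fix p assume "p \<in> Xpts f H0"
    then obtain v where v: "p = pt v" "v \<noteq> 0" "f v = 0" "B v n \<noteq> 0"
      by (auto simp: Xpts_def Q0pts_eq Qpts_def)
    then have "inverse (B v n) *s v \<in> A" "p = pt (inverse (B v n) *s v)"
      by (auto simp: A_def form_simps pt_scale)
    then show "p \<in> pt ` A" by blast
  qed
  show "pt ` A \<subseteq> Xpts f H0"
  proof
    fix p assume "p \<in> pt ` A"
    then obtain v where v: "p = pt v" "v \<in> A" by blast
    then have "\<not> pt v \<subseteq> H0" by (simp only: pt_subset_H0) (simp add: A_def)
    then show "p \<in> Xpts f H0"
      using v A_nonzero[OF v(2)] by (auto simp: Xpts_def Q0pts_def Qpts_def A_def)
  qed
qed

lemma ov_eq: "ov x = pt ` {p. p \<noteq> 0 \<and> f p = 0 \<and> B p n = 0 \<and> B p x = 0}"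
proof -
  have "pt p \<subseteq> perp f (pt x) \<longleftrightarrow> B p x = 0" for p
    by (simp add: span_subset_subspace subspace_perp perp_span) (simp add: perp_def B_sym)
  moreover have "ov x = {pt p | p. p \<noteq> 0 \<and> f p = 0 \<and> B p n = 0 \<and> pt p \<subseteq> perp f (pt x)}"
    unfolding ov_def phi0_def Q0pts_eq by blast
  ultimately show ?thesis by (simp only: setcompr_eq_image)
qed

lemma pt_in_ov:
  assumes "p \<noteq> 0"
  shows "pt p \<in> ov x \<longleftrightarrow> f p = 0 \<and> B p n = 0 \<and> B p x = 0"
proof
  assume "pt p \<in> ov x"
  then obtain r where r: "pt p = pt r" "f r = 0" "B r n = 0" "B r x = 0"
    by (auto simp: ov_eq)
  then have "p \<in> pt r" using vec.span_base by blast
  then show "f p = 0 \<and> B p n = 0 \<and> B p x = 0"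
    using r by (auto simp: vec.span_singleton form_simps)
qed (use assms in \<open>auto simp: ov_eq\<close>)

text \<open>Two singular vectors span a totally singular space exactly when they are orthogonal. The
  resulting line leaves \<open>H0\<close> because it contains \<open>x\<close>.\<close>

lemma Xadj_iff:
  assumes "x \<in> A" "y \<in> A"
  shows "Xadj f H0 (pt x) (pt y) \<longleftrightarrow> x \<noteq> y \<and> B x y = 0"
proof
  assume "Xadj f H0 (pt x) (pt y)"
  then obtain l where l: "pt x \<noteq> pt y" "vec.subspace l" "\<And>z. z \<in> l \<Longrightarrow> f z = 0" "pt x \<subseteq> l" "pt y \<subseteq> l"
    by (auto simp: Xadj_def Xlines_def Qlines_def totally_singular_def)
  then have "x \<in> l" "y \<in> l" by (auto simp: span_subset_subspace)
  then have "f (x + y) = 0" using l vec.subspace_add by blast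
  then show "x \<noteq> y \<and> B x y = 0" using l assms by (auto simp: f_add A_def)
next
  assume xy: "x \<noteq> y \<and> B x y = 0"
  let ?l = "vec.span {y, x}"
  have y: "y \<notin> pt x"
    using xy assms by (auto simp: A_def vec.span_singleton form_simps)
  have ts: "totally_singular f ?l"
    by (rule totally_singular_span) (use xy assms B_sym[of x y] in \<open>auto simp: A_def\<close>)
  have "vec.dim ?l = 2" using y A_nonzero[OF assms(1)] by (simp add: vec.dim_insert)
  moreover have "\<not> ?l \<subseteq> H0"
    using assms(1) by (auto simp: span_subset_subspace subspace_H0) (auto simp: H0_eq A_def B_sym)
  ultimately have L: "{p \<in> Qpts f. p \<subseteq> ?l} - Q0pts f H0 \<in> Xlines f H0"
    using ts by (auto simp: Xlines_def Qlines_def)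
  have "pt x \<in> Xpts f H0" "pt y \<in> Xpts f H0" using assms by (auto simp: Xpts_eq)
  then have "pt x \<in> {p \<in> Qpts f. p \<subseteq> ?l} - Q0pts f H0" "pt y \<in> {p \<in> Qpts f. p \<subseteq> ?l} - Q0pts f H0"
    by (simp_all add: Xpts_def vec.span_mono)
  moreover have "pt x \<noteq> pt y" using xy assms pt_eqD by blast
  ultimately show "Xadj f H0 (pt x) (pt y)" using L by (auto simp: Xadj_def)
qed

text \<open>Pairing \<open>n = a *s x + b *s y\<close> with \<open>n\<close> gives
  \<open>a = b\<close>, so \<open>y\<close> is \<open>x\<close> plus a multiple of \<open>n\<close>.
  Singularity of \<open>y\<close> restricts the factor to 0 or 1, and it is an inverse.\<close>

lemma nucleus_join_iff:
  assumes "x \<in> A" "y \<in> A"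
  shows "nucleus f H0 \<subseteq> vec.span (pt x \<union> pt y) \<longleftrightarrow> y = x + n"
proof -
  have "vec.span (pt x \<union> pt y) = vec.span {x, y}"
    by (simp add: vec.span_eq vec.span_mono) (simp add: vec.span_base)
  then have "nucleus f H0 \<subseteq> vec.span (pt x \<union> pt y) \<longleftrightarrow> (\<exists>a b. n = a *s x + b *s y)"
    by (simp add: nucleus_eq span_subset_subspace in_span_pair)
  also have "\<dots> \<longleftrightarrow> y = x + n"
  proof
    assume "\<exists>a b. n = a *s x + b *s y"
    then obtain a b where ab: "n = a *s x + b *s y" by blast
    have "B (a *s x + b *s y) n = 0" using ab by (metis B_self)
    then have "b = a" using assms by (simp add: form_simps A_def add_eq_0)
    then have n: "n = a *s (x + y)" using ab by (simp add: vec.scale_right_distrib)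
    then have a: "a \<noteq> 0" using n_nonzero by auto
    then have y: "y = x + inverse a *s n" by (simp add: n vadd_self_left)
    have "f (x + inverse a *s n) = 0" using assms(2) y by (simp add: A_def)
    then have "inverse a * inverse a = inverse a" using assms(1) by (simp add: A_def form_simps add_eq_0)
    then have "inverse a = 1" using a by simp
    with y show "y = x + n" by simp
  next
    assume "y = x + n"
    then have "n = 1 *s x + 1 *s y" by (simp add: vadd_self_left)
    then show "\<exists>a b. n = a *s x + b *s y" by blast
  qed
  finally show ?thesis .
qed

lemma collinear_singular:
  assumes "x \<in> A" "y \<in> A" "x \<noteq> y" "B x y = 0" "f p = 0" "B p x = 0" "B p y = 0"
  obtains a b where "p = a *s x + b *s y"
proof -
  have "y \<notin> pt x" using assms by (auto simp: A_def vec.span_singleton form_simps)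
  then have "p \<in> vec.span {x, y}"
    using singular_dependent[of x y p] assms A_nonzero[OF assms(1)] B_sym by (auto simp: A_def)
  then show thesis using that by (auto simp: in_span_pair)
qed

lemma ov_antipode: "ov (x + n) = ov x"
  by (auto simp: ov_eq form_simps)

text \<open>A common point is orthogonal to \<open>x\<close> and \<open>y\<close>, hence on the line
  joining them by \<open>collinear_singular\<close>, and that line meets \<open>H0\<close> only in
  the point of \<open>x + y\<close>.\<close>

lemma ov_Int_collinear:
  assumes "x \<in> A" "y \<in> A" "x \<noteq> y" "B x y = 0"
  shows "ov x \<inter> ov y = {pt (x + y)}"
proof
  show "ov x \<inter> ov y \<subseteq> {pt (x + y)}"
  proof
    fix P assume P: "P \<in> ov x \<inter> ov y"
    then obtain p where p: "P = pt p" "p \<noteq> 0" "f p = 0" "B p n = 0" "B p x = 0"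
      by (auto simp: ov_eq)
    with P have "B p y = 0" by (auto simp: pt_in_ov)
    then obtain a b where ab: "p = a *s x + b *s y"
      using collinear_singular[OF assms] p by blast
    then have "a = b" using p(4) assms by (simp add: A_def form_simps add_eq_0)
    then have "p = a *s (x + y)" using ab by (simp add: vec.scale_right_distrib)
    moreover have "a \<noteq> 0" using p(2) calculation by auto
    ultimately show "P \<in> {pt (x + y)}" using p(1) pt_scale by (metis singletonI)
  qed
  have "x + y \<noteq> 0" using assms(3) by (simp add: vadd_eq_0)
  then show "{pt (x + y)} \<subseteq> ov x \<inter> ov y"
    using assms B_sym[of x y] by (auto simp: pt_in_ov A_def form_simps)
qed

end

section \<open>Elliptic ovoids and tangency\<close>

text \<open>The additive map sending \<open>c\<close> to \<open>c ^ 2 + c\<close> has fibres of size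
  at most 2, so its image has index at most 2 and two elements outside it differ by an element of
  it.\<close>

lemma (in char2_form) artin_schreier:
  assumes "\<And>c. c ^ 2 + c \<noteq> (a::'a)" "\<And>c. c ^ 2 + c \<noteq> b"
  obtains c where "c ^ 2 + c = a + b"
proof -
  define g where "g c = c ^ 2 + c" for c :: 'a
  have g_add: "g (c + d) = g c + g d" for c d
    by (simp add: g_def power2_eq_square algebra_simps add_self add_self_left)
  have "card {c. g c = r} \<le> 2" if r: "r \<in> range g" for r
  proof -
    obtain d where d: "r = g d" using r by blast
    have "{c. g c = r} \<subseteq> {d, d + 1}"
    proof
      fix c assume "c \<in> {c. g c = r}"
      then have "g (c + d) = 0" by (simp add: g_add d add_self)
      then have "(c + d) * (c + d + 1) = 0" by (simp add: g_def power2_eq_square algebra_simps)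
      then have "c = d \<or> c + (d + 1) = 0" by (simp add: add_eq_0 add.assoc)
      then show "c \<in> {d, d + 1}" by (simp only: add_eq_0) simp
    qed
    then have "card {c. g c = r} \<le> card {d, d + 1}" by (intro card_mono) auto
    then show ?thesis by simp
  qed
  then have "(\<Sum>r\<in>range g. card {c. g c = r}) \<le> 2 * card (range g)"
    using sum_bounded_above[of "range g" "\<lambda>r. card {c. g c = r}" 2] by simp
  moreover have "CARD('a) \<le> (\<Sum>r\<in>range g. card {c. g c = r})"
  proof -
    have "(UNIV :: 'a set) = (\<Union>r\<in>range g. {c. g c = r})" by auto
    then show ?thesis by (metis card_UN_le finite)
  qed
  \<comment> \<open>The image and its translate by \<open>a\<close> are disjoint, so by the count
    above they fill the field; \<open>b\<close> must lie in the translate.\<close>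
  moreover have "range g \<inter> (+) a ` range g = {}"
  proof (rule ccontr)
    assume "range g \<inter> (+) a ` range g \<noteq> {}"
    then obtain c d where "g c = a + g d" by auto
    then have "g (c + d) = a" by (simp add: g_add add.assoc add_self)
    then show False using assms(1) by (simp add: g_def)
  qed
  then have "card (range g \<union> (+) a ` range g) = 2 * card (range g)"
    by (simp add: card_Un_disjoint card_image)
  ultimately have "range g \<union> (+) a ` range g = UNIV"
    by (intro card_seteq) auto
  moreover have "b \<notin> range g" using assms(2) by (auto simp: g_def)
  ultimately obtain c where "b = a + g c" by blast
  then have "g c = a + b" by (simp add: add_self_left)
  then show thesis using that by (simp add: g_def)
qed

context nucleus_form
begin

lemma totally_singular_ortho: "totally_singular f U \<Longrightarrow> u \<in> U \<Longrightarrow> w \<in> U \<Longrightarrow> B u w = 0"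
  unfolding totally_singular_def by (simp add: polar_def vec.subspace_add)

lemma exists_outside_span:
  assumes "vec.dim U = 2"
  obtains w where "w \<in> U" "w \<notin> vec.span {x :: 'a ^ 6}"
proof -
  have "\<not> U \<subseteq> vec.span {x}"
  proof
    assume "U \<subseteq> vec.span {x}"
    then have "vec.dim U \<le> vec.dim {x}" by (rule vec.dim_mono)
    with assms show False by (simp split: if_splits)
  qed
  then show thesis using that by blast
qed

lemma in_perp_pair: "w \<in> perp f {u, v} \<longleftrightarrow> B w u = 0 \<and> B w v = 0"
  by (auto simp: perp_def B_sym)

section \<open>The 4-dimensional sections \<open>perp f {x, n}\<close>\<close>

lemma section_dim:
  assumes "x \<in> A"
  shows "vec.dim (perp f {x, n}) = 4"
proof -
  have "vec.dim (UNIV :: ('a ^ 6) set) = vec.dim (UNIV \<inter> perp f {x, n}) + 2"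
    by (rule dim_hyperbolic) (use assms in \<open>auto simp: A_def\<close>)
  then show ?thesis by (simp add: card_cart_basis)
qed

lemma section_radical:
  assumes "x \<in> A" "r \<in> perp f {x, n}" "\<And>w. w \<in> perp f {x, n} \<Longrightarrow> B r w = 0"
  shows "r = 0"
  by (rule nd, rule radical_hyperbolic[of x n UNIV]) (use assms in \<open>auto simp: A_def\<close>)

text \<open>A totally singular plane contains some \<open>w\<close> orthogonal to \<open>x\<close>
  but not a multiple of it. Adding \<open>B w n *s x\<close> makes it orthogonal to \<open>n\<close>
  and keeps it singular.\<close>

lemma section_singular:
  assumes x: "x \<in> A"
  obtains s where "s \<in> perp f {x, n}" "s \<noteq> 0" "f s = 0"
proof -
  obtain U where U: "totally_singular f U" "vec.dim U = 2"
    using witt by (auto simp: witt_index_on_def)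
  have sub: "vec.subspace U" using U(1) by (simp add: totally_singular_def)
  have "\<exists>w\<in>U. w \<notin> pt x \<and> B w x = 0"
  proof (cases "\<forall>u\<in>U. B u x = 0")
    case True
    then show ?thesis using exists_outside_span[OF U(2)] by metis
  next
    case False
    then obtain u where u: "u \<in> U" "B u x \<noteq> 0" by blast
    obtain w where w: "w \<in> U" "w \<notin> pt u" using exists_outside_span[OF U(2)] .
    \<comment> \<open>The multiple of \<open>u\<close> cancels the product with \<open>x\<close>, so
      \<open>?w\<close> stays in \<open>U\<close> and becomes orthogonal to
      \<open>x\<close>.\<close>
    let ?w = "w + (B w x / B u x) *s u"
    have w': "?w \<in> U" using u w sub by (simp add: vec.subspace_add vec.subspace_scale)
    moreover have "?w \<notin> pt x"
    proof
      assume "?w \<in> pt x"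
      then obtain c where c: "?w = c *s x" by (auto simp: vec.span_singleton)
      have "B u ?w = 0" using totally_singular_ortho[OF U(1) u(1) w'] .
      then have "?w = 0" using u unfolding c by (simp add: B_scale_right)
      then show False using w(2) by (auto simp: vadd_eq_0 vec.span_singleton)
    qed
    moreover have "B ?w x = 0" using u by (simp add: form_simps)
    ultimately show ?thesis by blast
  qed
  then obtain w where w: "w \<in> U" "w \<notin> pt x" "B w x = 0" by blast
  then have fw: "f w = 0" using U(1) by (simp add: totally_singular_def)
  show thesis
  proof (rule that[of "w + B w n *s x"])
    show "w + B w n *s x \<in> perp f {x, n}" "f (w + B w n *s x) = 0"
      using w fw x by (auto simp: in_perp_pair form_simps A_def)
    show "w + B w n *s x \<noteq> 0"
      using w(2) by (auto simp: vadd_eq_0 vec.span_singleton)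
  qed
qed

lemma section_ov:
  assumes "vec.subspace S"
  shows "{p \<in> Q0pts f H0. p \<subseteq> S} = pt ` {v \<in> S. v \<noteq> 0 \<and> f v = 0 \<and> B v n = 0}"
proof -
  have "{p \<in> Q0pts f H0. p \<subseteq> S} = {pt v |v. (v \<noteq> 0 \<and> f v = 0 \<and> B v n = 0) \<and> pt v \<subseteq> S}"
    unfolding Q0pts_eq by blast
  then show ?thesis
    unfolding span_subset_subspace[OF assms] by (simp only: setcompr_eq_image) auto
qed

text \<open>The section is \<open>perp f {x, n}\<close>. A totally singular subspace of it extends
  by \<open>x\<close>, which is orthogonal to it and outside the section, so Witt index 2 of the
  whole space leaves at most 1 here.\<close>

lemma ov_elliptic:
  assumes x: "x \<in> A"
  shows "ov x \<in> elliptic_ovoids f H0"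
proof -
  let ?S = "perp f {x, n}"
  have "ov x = {p \<in> Q0pts f H0. p \<subseteq> ?S}"
    unfolding section_ov[OF subspace_perp] ov_eq by (rule arg_cong[of _ _ "image pt"]) (auto simp: in_perp_pair)
  moreover have "?S \<subseteq> H0" by (auto simp: H0_eq in_perp_pair B_n_left)
  moreover have "nondeg_on f ?S" using section_radical[OF x] by (auto simp: nondeg_on_def)
  moreover have "witt_index_on f ?S 1"
    unfolding witt_index_on_def
  proof (intro conjI allI impI)
    obtain s where s: "s \<in> ?S" "s \<noteq> 0" "f s = 0" using section_singular[OF x] .
    have "totally_singular f (pt s)" by (rule totally_singular_span) (use s in auto)
    moreover have "pt s \<subseteq> ?S" using s(1) by (simp add: span_subset_subspace subspace_perp)
    ultimately show "\<exists>U\<subseteq>?S. totally_singular f U \<and> vec.dim U = 1" using s(2) by (auto intro!: exI[of _ "pt s"])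
  next
    fix U assume U: "U \<subseteq> ?S \<and> totally_singular f U"
    have "vec.span U \<subseteq> ?S" using U by (simp add: span_subset_subspace subspace_perp)
    moreover have "x \<notin> ?S" using x by (auto simp: in_perp_pair A_def)
    ultimately have "vec.dim (insert x U) = vec.dim U + 1" by (auto simp: vec.dim_insert)
    moreover have "totally_singular f (vec.span (insert x U))"
    proof (rule totally_singular_span)
      show "f v = 0" if "v \<in> insert x U" for v
        using that U x by (auto simp: A_def totally_singular_def)
      show "B v w = 0" if "v \<in> insert x U" "w \<in> insert x U" for v w
        using that U totally_singular_ortho[of U v w] by (auto simp: in_perp_pair subset_iff B_sym)
    qed
    ultimately show "vec.dim U \<le> 1" using witt_le_2 by fastforce
  qed
  ultimately show ?thesis
    unfolding elliptic_ovoids_def using section_dim[OF x] subspace_perp[of "{x, n}"]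
    by (intro CollectI exI[of _ ?S] conjI)
qed

text \<open>Singular vectors span the section of \<open>x\<close>, so \<open>y\<close> is orthogonal
  to all of it and lies in the span of \<open>x\<close> and \<open>n\<close>. Singularity of
  \<open>y\<close> leaves two candidates.\<close>

lemma ov_subset_imp:
  assumes xy: "x \<in> A" "y \<in> A" and sub: "ov x \<subseteq> ov y"
  shows "y = x \<or> y = x + n"
proof -
  let ?S = "perp f {x, n}"
  have sing: "B s y = 0" if "s \<in> ?S" "f s = 0" for s
  proof (cases "s = 0")
    case False
    then have "pt s \<in> ov x" using that by (simp add: pt_in_ov in_perp_pair)
    then show ?thesis using sub False pt_in_ov by blast
  qed simp
  obtain u where u: "u \<in> ?S" "u \<noteq> 0" "f u = 0" using section_singular[OF xy(1)] .
  have 1: "B s y = 0" if s: "s \<in> ?S" "B s u \<noteq> 0" for s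
  proof -
    \<comment> \<open>The coefficient makes this vector singular: a line through \<open>u\<close>
      not orthogonal to it carries a second singular point.\<close>
    have "B (s + (f s / B s u) *s u) y = 0"
      by (rule sing) (use s u in \<open>auto simp: in_perp_pair form_simps\<close>)
    then show ?thesis using sing[OF u(1,3)] by (simp add: form_simps)
  qed
  obtain t where t: "t \<in> ?S" "B u t \<noteq> 0" using section_radical[OF xy(1) u(1)] u(2) by blast
  have 2: "B y s = 0" if s: "s \<in> ?S" for s
  proof (cases "B s u = 0")
    case True
    \<comment> \<open>Adding \<open>t\<close> moves \<open>s\<close> out of the complement of
      \<open>u\<close>, so the previous case covers both \<open>s + t\<close> and
      \<open>t\<close>.\<close>
    have "B (s + t) y = 0"
      by (rule 1) (use True s t B_sym[of u t] in \<open>auto simp: in_perp_pair form_simps\<close>)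
    moreover have "B t y = 0"
      by (rule 1) (use t B_sym[of u t] in auto)
    ultimately show ?thesis using B_sym[of y] by (simp add: B_add_left)
  qed (use 1 s B_sym[of y] in auto)
  have "y + (B y n *s x + B y x *s n) = 0"
  proof (rule section_radical[OF xy(1)])
    show "y + (B y n *s x + B y x *s n) \<in> ?S"
      by (rule hyperbolic_decomp) (use xy in \<open>simp add: A_def\<close>)
    show "B (y + (B y n *s x + B y x *s n)) w = 0" if "w \<in> ?S" for w
      using 2[OF that] that B_sym[of _ w] by (simp add: in_perp_pair form_simps)
  qed
  then have y: "y = x + B y x *s n" using xy by (simp add: vadd_eq_0 A_def)
  define b where "b = B y x"
  have "f (x + b *s n) = 0" using xy(2) y by (simp add: A_def b_def)
  then have "b * (b + 1) = 0" using xy by (simp add: A_def form_simps algebra_simps)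
  then have "b = 0 \<or> b = 1" by (simp add: add_eq_0)
  then show ?thesis using y by (auto simp: b_def)
qed

lemma ov_eq_iff: "x \<in> A \<Longrightarrow> y \<in> A \<Longrightarrow> ov x = ov y \<longleftrightarrow> y = x \<or> y = x + n"
  using ov_subset_imp ov_antipode by blast

text \<open>Converse of \<open>ov_elliptic\<close>. \<open>S\<close> splits into a hyperbolic plane
  and an anisotropic plane \<open>T\<close>, and its complement contains \<open>n\<close> and some
  \<open>m\<close> with \<open>B n m = 1\<close>. If no \<open>m + c *s n\<close> were singular,
  this complementary plane would be anisotropic too; two such planes together contain a totally
  singular plane, which with \<open>u\<close> contradicts Witt index 2.\<close>

lemma elliptic_section:
  assumes S: "vec.subspace S" "S \<subseteq> H0" "vec.dim S = 4" "nondeg_on f S" "witt_index_on f S 1"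
  obtains x where "x \<in> A" "S = perp f {x, n}"
proof -
  have Sn: "B s n = 0" "B n s = 0" if "s \<in> S" for s
    using that S(2) by (auto simp: H0_eq B_sym)
  have radS: "r = 0" if "r \<in> S" "\<And>w. w \<in> S \<Longrightarrow> B r w = 0" for r
    using even_dim_nondegenerate[OF S(1) _ S(4)] S(3) that by auto
  obtain U where U: "U \<subseteq> S" "totally_singular f U" "vec.dim U = 1"
    using S(5) by (auto simp: witt_index_on_def)
  have "\<not> U \<subseteq> {0}" using U(3) by (metis vec.dim_eq_0 zero_neq_one)
  then obtain u where u: "u \<in> S" "u \<noteq> 0" "f u = 0" using U by (auto simp: totally_singular_def)
  obtain v where v: "v \<in> S" "B u v = 1" using radS[OF u(1)] u(2) hyperbolic_pair[OF S(1) u(1)] by metis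
  define T where "T = S \<inter> perp f {u, v}"
  have subT: "vec.subspace T" unfolding T_def using S(1) subspace_perp by (rule vec.subspace_inter)
  have dimT: "vec.dim T = 2" using dim_hyperbolic[OF S(1) u(1) v] S(3) by (simp add: T_def)
  have T: "t \<in> S" "B t u = 0" "B t v = 0" "B t n = 0" "B u t = 0" "B v t = 0" "B n t = 0" if "t \<in> T" for t
    using that Sn[of t] by (auto simp: T_def in_perp_pair B_sym)
  have anisotropic: "t = 0" if t: "t \<in> T" "f t = 0" for t
  proof (rule ccontr)
    assume "t \<noteq> 0"
    \<comment> \<open>A nonzero singular \<open>t\<close> in \<open>T\<close> would join with
      \<open>u\<close> to a totally singular plane inside \<open>S\<close>, whose Witt index is
      1.\<close>
    have "totally_singular f (vec.span {t, u})"
      by (rule totally_singular_span) (use u t T in auto)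
    moreover have "vec.span {t, u} \<subseteq> S" using S(1) u T(1)[OF t(1)] by (simp add: span_subset_subspace)
    ultimately have "vec.dim (vec.span {t, u}) \<le> 1" using S(5) unfolding witt_index_on_def by blast
    moreover have "t \<notin> pt u" using \<open>t \<noteq> 0\<close> v(2) T(3)[OF t(1)] by (auto simp: vec.span_singleton form_simps)
    ultimately show False using u(2) by (simp add: vec.dim_insert)
  qed
  have "\<not> T \<subseteq> {0}" using dimT by (metis vec.dim_eq_0 zero_neq_numeral)
  then obtain t0 where "t0 \<in> T" "t0 \<noteq> 0" by blast
  moreover from this have "f t0 \<noteq> 0" using anisotropic by blast
  then obtain k where "k \<noteq> 0" "f (k *s t0) = 1" by (rule scale_to_1)
  ultimately obtain t1 where t1: "t1 \<in> T" "f t1 = 1" using subT vec.subspace_scale by metis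
  have "\<exists>w\<in>T. B t1 w \<noteq> 0"
  proof (rule ccontr)
    assume "\<not> (\<exists>w\<in>T. B t1 w \<noteq> 0)"
    then have "B t1 w = 0" if "w \<in> S" for w
      using radical_hyperbolic[OF v(2) S(1) u(1) v(1) _ _ that] t1(1) by (auto simp: T_def)
    then have "t1 = 0" using radS T(1)[OF t1(1)] by blast
    then show False using t1(2) by simp
  qed
  then obtain t2 where t2: "t2 \<in> T" "B t1 t2 = 1" using hyperbolic_pair[OF subT t1(1)] by metis
  have "vec.dim (T \<inter> perp f {t1, t2}) = 0" using dim_hyperbolic[OF subT t1(1) t2] dimT by simp
  then have T0: "T \<inter> perp f {t1, t2} \<subseteq> {0}" by simp

  obtain w0 where w0: "B n w0 \<noteq> 0" using nd n_nonzero by blast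
  \<comment> \<open>Two successive projections, off the pairs \<open>u\<close>, \<open>v\<close> and
    \<open>t1\<close>, \<open>t2\<close>, make the vector orthogonal to \<open>S\<close>. All four
    vectors lie in \<open>H0\<close>, so the product with \<open>n\<close> stays nonzero.\<close>
  define w1 where "w1 = w0 + (B w0 v *s u + B w0 u *s v)"
  define w2 where "w2 = w1 + (B w1 t2 *s t1 + B w1 t1 *s t2)"
  have "w1 \<in> perp f {u, v}" unfolding w1_def by (rule hyperbolic_decomp[OF v(2)])
  then have w2uv: "w2 \<in> perp f {u, v}" using t1 t2 by (simp add: w2_def in_perp_pair form_simps T)
  have w2t: "w2 \<in> perp f {t1, t2}" unfolding w2_def by (rule hyperbolic_decomp[OF t2(2)])
  have "B w2 t = 0" if "t \<in> T" for t
    by (rule radical_hyperbolic[OF t2(2) subT t1(1) t2(1) w2t _ that]) (use T0 in auto)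
  then have w2S: "B w2 s = 0" if "s \<in> S" for s
    using radical_hyperbolic[OF v(2) S(1) u(1) v(1) w2uv _ that] by (auto simp: T_def)
  have "B n w2 = B n w0"
    using t1 t2 Sn u v by (simp add: w1_def w2_def form_simps T)
  with w0 have "B n w2 \<noteq> 0" by simp
  then obtain m where m: "B n m = 1" "\<And>s. s \<in> S \<Longrightarrow> B m s = 0"
    using w2S by (intro that[of "inverse (B n w2) *s w2"]) (auto simp: form_simps)
  have mn: "B m n = 1" "\<And>s. s \<in> S \<Longrightarrow> B s m = 0" using m B_sym by metis+

  \<comment> \<open>This equation says that \<open>m + c *s n\<close> is singular.\<close>
  obtain c where c: "c ^ 2 + c = f m"
  proof (rule ccontr)
    assume "\<not> thesis"
    then have no_c: "c ^ 2 + c \<noteq> f m" for c using that by blast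
    \<comment> \<open>A solution would make \<open>t2 + c *s t1\<close> a nonzero singular vector of
      \<open>T\<close>.\<close>
    have "c ^ 2 + c \<noteq> f t2" for c
    proof
      assume "c ^ 2 + c = f t2"
      then have "f (t2 + c *s t1) = 0"
        using t1 t2 B_sym[of t2 t1] by (simp add: f_add f_scale B_scale_right add_self) (metis add.assoc add_self add.commute)
      then have "t2 + c *s t1 = 0"
        using anisotropic t1 t2 subT by (simp add: vec.subspace_add vec.subspace_scale)
      then have "B t1 (t2 + c *s t1) = 0" by simp
      then show False using t2 by (simp add: form_simps)
    qed
    then obtain c where c: "c ^ 2 + c = f m + f t2" using artin_schreier[OF no_c] by blast
    \<comment> \<open>Both vectors are singular because values coming from the two planes cancel,
      and \<open>B n m + B t1 t2 = 1 + 1 = 0\<close> makes them orthogonal.\<close>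
    let ?e = "n + t1" and ?g = "m + t2 + c *s n"
    note vals = T[OF t1(1)] T[OF t2(1)] t1(2) t2(2) m(1) mn(1) m(2)[OF u(1)] m(2)[OF v(1)]
      m(2)[OF T(1)[OF t1(1)]] m(2)[OF T(1)[OF t2(1)]]
      mn(2)[OF u(1)] mn(2)[OF v(1)] mn(2)[OF T(1)[OF t1(1)]] mn(2)[OF T(1)[OF t2(1)]]
      Sn[OF u(1)] Sn[OF v(1)] u v(2) B_sym[of t2 t1]
    have e: "?e \<notin> pt u"
    proof
      assume "?e \<in> pt u"
      then obtain k where "?e = k *s u" by (auto simp: vec.span_singleton)
      then have "B ?e m = B (k *s u) m" by simp
      then show False by (simp add: form_simps vals)
    qed
    have "f ?g = f m + f t2 + (c ^ 2 + c)" by (simp add: f_add f_scale B_add_left B_add_right B_scale_right vals algebra_simps)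
    then have "f ?g = 0" by (simp add: c add_self)
    then have "?g \<in> vec.span {u, ?e}"
      by (intro singular_dependent) (use e in \<open>auto simp: form_simps vals\<close>)
    then obtain a b where "?g = a *s u + b *s ?e" by (auto simp: in_span_pair)
    \<comment> \<open>Pairing with \<open>n\<close> gives 1 for \<open>?g\<close> but 0 for every
      combination of \<open>u\<close> and \<open>?e\<close>.\<close>
    then have "B ?g v = B (a *s u + b *s ?e) v" "B ?g n = B (a *s u + b *s ?e) n" by auto
    then show False by (simp add: form_simps vals)
  qed
  define x where "x = m + c *s n"
  have "f x = f m + (c ^ 2 + c)"
    by (simp add: x_def f_add f_scale B_scale_right mn add.assoc)
  then have xA: "x \<in> A" by (simp add: A_def c add_self) (simp add: x_def form_simps mn)
  moreover have "S = perp f {x, n}"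
  proof (rule vec.subspace_dim_equal[OF S(1) subspace_perp])
    show "S \<subseteq> perp f {x, n}" using Sn mn by (auto simp: in_perp_pair x_def form_simps)
    show "vec.dim (perp f {x, n}) \<le> vec.dim S" using section_dim[OF xA] S(3) by simp
  qed
  ultimately show thesis by (rule that)
qed

lemma elliptic_ovoids_eq: "elliptic_ovoids f H0 = ov ` A"
proof
  show "ov ` A \<subseteq> elliptic_ovoids f H0" using ov_elliptic by blast
  show "elliptic_ovoids f H0 \<subseteq> ov ` A"
  proof
    fix O1 assume "O1 \<in> elliptic_ovoids f H0"
    then obtain S where S: "O1 = {p \<in> Q0pts f H0. p \<subseteq> S}" "vec.subspace S" "S \<subseteq> H0" "vec.dim S = 4"
      "nondeg_on f S" "witt_index_on f S 1" by (auto simp: elliptic_ovoids_def)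
    obtain x where x: "x \<in> A" "S = perp f {x, n}" using elliptic_section[OF S(2-)] .
    have "O1 = ov x"
      unfolding S(1) section_ov[OF S(2)] unfolding ov_eq x(2)
      by (rule arg_cong[of _ _ "image pt"]) (auto simp: in_perp_pair)
    with x show "O1 \<in> ov ` A" by blast
  qed
qed

text \<open>With \<open>b = B x y\<close>, write \<open>y = r + x + b *s n\<close> where
  \<open>r\<close> lies in the section of \<open>x\<close> and \<open>f r = b * (b + 1)\<close>. For
  \<open>b\<close> other than 0 and 1, \<open>r\<close> is nonsingular and the common points form a
  conic with nucleus \<open>r\<close>, which has more than one point. Otherwise \<open>x\<close> is
  collinear with \<open>y\<close> or \<open>y + n\<close>.\<close>

lemma tangent_iff:
  assumes xy: "x \<in> A" "y \<in> A"
  shows "tangent (ov x) (ov y) \<longleftrightarrow> y \<noteq> x \<and> y \<noteq> x + n \<and> (B x y = 0 \<or> B x y = 1)"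
proof
  assume tan: "tangent (ov x) (ov y)"
  then have ne: "y \<noteq> x \<and> y \<noteq> x + n" using xy ov_eq_iff by (auto simp: tangent_def)
  define b where "b = B x y"
  have "b = 0 \<or> b = 1"
  proof (rule ccontr)
    assume b: "\<not> (b = 0 \<or> b = 1)"
    define r where "r = y + (x + b *s n)"
    let ?S = "perp f {x, n}"
    have rS: "r \<in> ?S" using xy B_sym[of y x] by (simp add: in_perp_pair r_def b_def form_simps A_def B_n_left)
    have "f r = b * (b + 1)"
      using xy B_sym[of y x] by (simp add: r_def form_simps A_def b_def B_n_left algebra_simps)
    then have fr: "f r \<noteq> 0" using b by (simp add: add_eq_0)
    then have "r \<noteq> 0" by auto
    then obtain u where u: "u \<in> ?S" "B r u = 1"
      using section_radical[OF xy(1) rS] hyperbolic_pair[OF subspace_perp rS] by metis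
    \<comment> \<open>A plane complementary to \<open>r\<close> in the vectors of \<open>?S\<close>
      orthogonal to \<open>r\<close>: its points index the lines through the nucleus of the
      conic.\<close>
    let ?M = "?S \<inter> perp f {r, u}"
    have "vec.dim ?M = 2"
      using dim_hyperbolic[OF subspace_perp rS u] section_dim[OF xy(1)] by simp
    then obtain w1 where w1: "w1 \<in> ?M" "w1 \<notin> pt 0" by (rule exists_outside_span)
    obtain w2 where w2: "w2 \<in> ?M" "w2 \<notin> pt w1" using exists_outside_span[OF \<open>vec.dim ?M = 2\<close>] .
    have key: "\<exists>c. w + c *s r \<noteq> 0 \<and> pt (w + c *s r) \<in> ov x \<inter> ov y" if w: "w \<in> ?M" "w \<noteq> 0" for w
    proof -
      \<comment> \<open>Since \<open>w\<close> and \<open>r\<close> are orthogonal, this square root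
        makes \<open>w + c *s r\<close> singular, giving a common point on each line through the
        nucleus.\<close>
      obtain c where c: "c ^ 2 = f w / f r" using square_root by blast
      have v: "B w r = 0" "B w u = 0" "B w x = 0" "B w n = 0" "B r x = 0" "B r n = 0"
        using w rS by (auto simp: in_perp_pair)
      have nz: "w + c *s r \<noteq> 0"
      proof
        assume z: "w + c *s r = 0"
        then have "B (w + c *s r) u = 0" by simp
        then have "c = 0" using u v by (simp add: form_simps)
        with z w show False by simp
      qed
      have "f (w + c *s r) = 0" using c fr v by (simp add: f_add f_scale B_scale_right add_self)
      moreover have y: "y = r + (x + b *s n)" unfolding r_def by (simp only: add.assoc vadd_self add.right_neutral)
      have "B (w + c *s r) y = 0" unfolding y using v by (simp add: form_simps)
      ultimately show ?thesis using nz v by (auto simp: pt_in_ov form_simps intro!: exI[of _ c])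
    qed
    obtain c1 where c1: "w1 + c1 *s r \<noteq> 0" "pt (w1 + c1 *s r) \<in> ov x \<inter> ov y"
      using key[OF w1(1)] w1(2) by (auto simp: vec.span_zero)
    obtain c2 where c2: "pt (w2 + c2 *s r) \<in> ov x \<inter> ov y"
      using key[OF w2(1)] w2(2) vec.span_zero by blast
    have "pt (w1 + c1 *s r) = pt (w2 + c2 *s r)"
      using tan c1 c2 by (auto simp: tangent_def card_1_singleton_iff)
    then have "w2 + c2 *s r \<in> pt (w1 + c1 *s r)" using vec.span_base by blast
    then obtain k where k: "w2 + c2 *s r = k *s (w1 + c1 *s r)" by (auto simp: vec.span_singleton)
    then have "B (w2 + c2 *s r) u = B (k *s (w1 + c1 *s r)) u" by simp
    then have "c2 = k * c1" using w1 w2 u by (simp add: form_simps in_perp_pair)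
    then have "w2 = k *s w1" using k by (simp add: vec.scale_right_distrib)
    with w2(2) show False by (auto simp: vec.span_singleton)
  qed
  with ne show "y \<noteq> x \<and> y \<noteq> x + n \<and> (B x y = 0 \<or> B x y = 1)" by (simp add: b_def)
next
  assume r: "y \<noteq> x \<and> y \<noteq> x + n \<and> (B x y = 0 \<or> B x y = 1)"
  then have ne: "ov x \<noteq> ov y" using xy ov_eq_iff by blast
  from r consider "B x y = 0" | "B x (y + n) = 0" using A_B_antipode[OF xy] two by metis
  then show "tangent (ov x) (ov y)"
  proof cases
    case 1
    then show ?thesis using ov_Int_collinear[OF xy] r ne by (auto simp: tangent_def)
  next
    case 2
    have "x \<noteq> y + n" using r by (auto simp: add.assoc vadd_self)
    then show ?thesis
      using ov_Int_collinear[OF xy(1) A_antipode[OF xy(2)]] 2 ne by (auto simp: tangent_def ov_antipode)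
  qed
qed

section \<open>Configurations and cliques\<close>

text \<open>A frame is one half of a centric configuration, choosing one vector from each antipodal
  pair; for \<open>k \<ge> 3\<close> it is also a lift of a non-linear clique.\<close>

definition frames :: "nat \<Rightarrow> ('a ^ 6) set set" where
  "frames k = {Y. Y \<subseteq> A \<and> card Y = k \<and> (\<forall>x\<in>Y. \<forall>y\<in>Y. x \<noteq> y \<longrightarrow> B x y = 1)}"

text \<open>A third member \<open>z\<close> would need product 1 with both \<open>x\<close> and
  \<open>x + n\<close>, but these products differ by 1. For \<open>k = 2\<close> the pair
  \<open>x\<close>, \<open>x + n\<close> itself is a frame.\<close>

lemma frame_no_antipodes:
  assumes Y: "Y \<in> frames k" "k \<ge> 3" and xy: "x \<in> Y" "y \<in> Y"
  shows "y \<noteq> x + n"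
proof
  assume y: "y = x + n"
  have "card (Y - {x, y}) > 0"
  proof -
    have "card Y \<le> card (Y - {x, y}) + card {x, y}"
      using diff_card_le_card_Diff[of "{x, y}" Y] by simp
    moreover have "card {x, y} \<le> 2" by (simp add: card_insert_if)
    ultimately show ?thesis using Y by (simp add: frames_def)
  qed
  then obtain z where z: "z \<in> Y" "z \<noteq> x" "z \<noteq> y" by (metis card_gt_0_iff DiffE ex_in_conv insertCI)
  then have "B z x = 1" "B z (x + n) = 1" "z \<in> A" "x \<in> A"
    using Y xy y by (auto simp: frames_def)
  then show False using A_B_antipode[of z x] by (simp add: two_eq_0)
qed

lemma frame_ov_inj:
  assumes "Y \<in> frames k" "k \<ge> 3"
  shows "inj_on ov Y"
proof (rule inj_onI)
  fix x y assume "x \<in> Y" "y \<in> Y" "ov x = ov y"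
  then show "x = y"
    using ov_eq_iff[of x y] frame_no_antipodes[OF assms, of x y] assms by (auto simp: frames_def)
qed

section \<open>Frames and centric configurations\<close>

definition cover :: "('a ^ 6) set \<Rightarrow> 'a pt set" where
  "cover Y = pt ` (Y \<union> (\<lambda>y. y + n) ` Y)"

lemma image_pairs: "(\<lambda>(i, a). g i a) ` (I \<times> {1, 2 :: nat}) = (\<lambda>i. g i 1) ` I \<union> (\<lambda>i. g i 2) ` I"
  by (auto simp: image_iff)

lemma cover_config:
  assumes Y: "Y \<in> frames k" and k: "k \<ge> 3"
  shows "cover Y \<in> centric_configs f H0 k"
proof -
  have YA: "Y \<subseteq> A" and cY: "card Y = k" using Y by (auto simp: frames_def)
  then have "finite Y" using k by (metis card.infinite not_numeral_le_zero)
  then obtain h where h: "bij_betw h {1..k} Y"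
    using ex_bij_betw_nat_finite_1 cY by blast
  define v where "v i a = (if a = 1 then h i else h i + n)" for i and a :: nat
  have hY: "h i \<in> Y" if "i \<in> {1..k}" for i using h that by (auto simp: bij_betw_def)
  have hA: "h i \<in> A" if "i \<in> {1..k}" for i using hY[OF that] YA by blast
  have h_inj: "h i = h j \<longleftrightarrow> i = j" if "i \<in> {1..k}" "j \<in> {1..k}" for i j
    using h that inj_on_eq_iff[of h "{1..k}"] by (simp add: bij_betw_def)
  have h_anti: "h j \<noteq> h i + n" if "i \<in> {1..k}" "j \<in> {1..k}" for i j
    using frame_no_antipodes[OF Y k] hY that by blast
  have hB: "B (h i) (h j) = (if i = j then 0 else 1)" if "i \<in> {1..k}" "j \<in> {1..k}" for i j
    using Y hY h_inj that by (auto simp: frames_def)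
  have vA: "v i a \<in> A" if "i \<in> {1..k}" for i a using hA[OF that] A_antipode by (simp add: v_def)
  have v_inj: "i = j \<and> a = b" if "i \<in> {1..k}" "j \<in> {1..k}" "a \<in> {1, 2}" "b \<in> {1, 2}" "v i a = v j b" for i j a b
    using that h_inj h_anti[OF that(1,2)] h_anti[OF that(2,1)] by (auto simp: v_def split: if_splits)
  \<comment> \<open>Passing to one antipode adds 1 and two such changes cancel. Between distinct
    pairs the value is thus 0 exactly for \<open>a \<noteq> b\<close>; within a pair it is 1 there,
    so antipodes are not adjacent.\<close>
  have vB: "B (v i a) (v j b) = B (h i) (h j) + (if a = b then 0 else 1)"
    if "i \<in> {1..k}" "j \<in> {1..k}" "a \<in> {1, 2}" "b \<in> {1, 2}" for i j a b
    using that A_B_antipode[OF hA hA, OF that(1,2)] A_B_antipode_left[OF hA hA, OF that(1,2)]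
      A_B_antipode_left[OF hA A_antipode[OF hA], OF that(1,2)]
    by (auto simp: v_def add.assoc two_eq_0)
  show ?thesis
    unfolding centric_configs_def
  proof (intro CollectI exI[of _ "\<lambda>i a. pt (v i a)"] conjI ballI)
    show "inj_on (\<lambda>(i, a). pt (v i a)) ({1..k} \<times> {1, 2})"
    proof (rule inj_onI, clarify)
      fix i a j b
      assume *: "i \<in> {1..k}" "j \<in> {1..k}" "a \<in> {1, 2}" "b \<in> {1, 2::nat}" "pt (v i a) = pt (v j b)"
      then have "v i a = v j b" using pt_eqD vA by blast
      then show "i = j \<and> a = b" using v_inj * by blast
    qed
    have "Y \<union> (\<lambda>y. y + n) ` Y = (\<lambda>(i, a). v i a) ` ({1..k} \<times> {1, 2})"
    proof -
      have "(\<lambda>(i, a). v i a) ` ({1..k} \<times> {1, 2}) = h ` {1..k} \<union> (\<lambda>y. y + n) ` h ` {1..k}"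
        unfolding v_def image_pairs image_image by simp
      then show ?thesis using h by (simp add: bij_betw_def)
    qed
    then show "cover Y = (\<lambda>(i, a). pt (v i a)) ` ({1..k} \<times> {1, 2})"
      by (simp add: cover_def image_image case_prod_unfold)
    show "pt (v i a) \<in> Xpts f H0" if "i \<in> {1..k}" for i a
      using vA[OF that] by (auto simp: Xpts_eq)
    show "Xadj f H0 (pt (v i a)) (pt (v j b)) \<longleftrightarrow> i \<noteq> j \<and> a \<noteq> b"
      if "i \<in> {1..k}" "a \<in> {1, 2}" "j \<in> {1..k}" "b \<in> {1, 2}" for i a j b
      using that vB[OF that(1,3,2,4)] hB[OF that(1,3)] v_inj[OF that(1,3,2,4)]
      by (auto simp: Xadj_iff vA two_eq_0 add_self)
    show "nucleus f H0 \<subseteq> vec.span (pt (v i 1) \<union> pt (v i 2))" if "i \<in> {1..k}" for i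
      using that by (simp add: nucleus_join_iff vA) (simp add: v_def)
  qed
qed

text \<open>The points with \<open>a = 1\<close> give the frame: the nucleus condition forces
  \<open>x i 2\<close> to be the antipode of \<open>x i 1\<close>, and adjacency of
  \<open>x i 1\<close> with \<open>x j 2\<close> then reads
  \<open>B (y i) (y j) = 1\<close>.\<close>

lemma config_cover:
  assumes C: "C \<in> centric_configs f H0 k"
  obtains Y where "Y \<in> frames k" "C = cover Y"
proof -
  obtain x where inj: "inj_on (\<lambda>(i, a). x i a) ({1..k} \<times> {1, 2::nat})"
    and CX: "C = (\<lambda>(i, a). x i a) ` ({1..k} \<times> {1, 2})"
    and X: "\<forall>i\<in>{1..k}. \<forall>a\<in>{1, 2}. x i a \<in> Xpts f H0"
    and adj: "\<forall>i\<in>{1..k}. \<forall>a\<in>{1,2}. \<forall>j\<in>{1..k}. \<forall>b\<in>{1,2}.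
          Xadj f H0 (x i a) (x j b) \<longleftrightarrow> i \<noteq> j \<and> a \<noteq> b"
    and anti: "\<forall>i\<in>{1..k}. nucleus f H0 \<subseteq> vec.span (x i 1 \<union> x i 2)"
    using C unfolding centric_configs_def by blast
  define y where "y i = (SOME v. v \<in> A \<and> x i 1 = pt v)" for i
  have y: "y i \<in> A" "x i 1 = pt (y i)" if "i \<in> {1..k}" for i
  proof -
    have "x i 1 \<in> pt ` A" using X that unfolding Xpts_eq by blast
    then have "\<exists>v. v \<in> A \<and> x i 1 = pt v" by blast
    from someI_ex[OF this] show "y i \<in> A" "x i 1 = pt (y i)" by (auto simp: y_def)
  qed
  have y2: "x i 2 = pt (y i + n)" if i: "i \<in> {1..k}" for i
  proof -
    have "x i 2 \<in> pt ` A" using X i unfolding Xpts_eq by blast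
    then obtain z where z: "z \<in> A" "x i 2 = pt z" by blast
    then have "z = y i + n" using anti i y[OF i] nucleus_join_iff by metis
    with z show ?thesis by simp
  qed
  have y_inj: "inj_on y {1..k}"
  proof (rule inj_onI)
    fix i j assume ij: "i \<in> {1..k}" "j \<in> {1..k}" "y i = y j"
    then have "x i 1 = x j 1" using y by simp
    then show "i = j" using inj_onD[OF inj, of "(i, 1)" "(j, 1)"] ij by auto
  qed
  have yB: "B (y i) (y j) = 1" if ij: "i \<in> {1..k}" "j \<in> {1..k}" "i \<noteq> j" for i j
  proof -
    have "Xadj f H0 (pt (y i)) (pt (y j + n))"
      using adj ij y(2)[OF ij(1)] y2[OF ij(2)] by (metis insertI1 insertI2 num.distinct(1) one_eq_numeral_iff)
    then have "B (y i) (y j + n) = 0" using Xadj_iff y A_antipode ij by blast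
    then show ?thesis using A_B_antipode y ij by (simp add: add_eq_0)
  qed
  show thesis
  proof (rule that[of "y ` {1..k}"])
    show "y ` {1..k} \<in> frames k"
      using y(1) yB y_inj unfolding frames_def by (auto simp: card_image) (metis)
    have "C = (\<lambda>i. x i 1) ` {1..k} \<union> (\<lambda>i. x i 2) ` {1..k}"
      unfolding CX image_pairs ..
    also have "\<dots> = cover (y ` {1..k})"
      unfolding cover_def image_Un image_image using y y2 by (intro arg_cong2[of _ _ _ _ "(\<union>)"] image_cong) auto
    finally show "C = cover (y ` {1..k})" .
  qed
qed

lemma centric_configs_eq: "k \<ge> 3 \<Longrightarrow> centric_configs f H0 k = cover ` frames k"
  using cover_config config_cover by blast

lemma phi0_cover: "phi0 f H0 ` cover Y = ov ` Y"
proof -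
  have "phi0 f H0 ` cover Y = ov ` (Y \<union> (\<lambda>y. y + n) ` Y)"
    by (simp add: cover_def image_image ov_def)
  then show ?thesis by (simp add: image_Un image_image ov_antipode)
qed

text \<open>The points of \<open>A\<close> on the line through collinear \<open>x, y\<close> are the vectors \<open>x + c (x + y)\<close>.\<close>

lemma line_rosette:
  assumes xy: "x \<in> A" "y \<in> A" "x \<noteq> y" "B x y = 0"
  shows "rosette f H0 (pt (x + y)) (range (\<lambda>c. ov (x + c *s (x + y))))"
proof -
  define w where "w = x + y"
  define l where "l c = x + c *s w" for c
  have w: "w \<noteq> 0" "f w = 0" "B w n = 0" "B x w = 0" "B w x = 0"
    using xy B_sym[of y x] by (auto simp: w_def vadd_eq_0 form_simps A_def)
  have lA: "l c \<in> A" for c using w xy by (simp add: l_def A_def form_simps)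
  have lB: "B (l c) (l d) = 0" for c d
    using w xy by (simp add: l_def form_simps)
  have l_add: "l c + l d = (c + d) *s w" for c d
    by (simp add: l_def vec.scale_left_distrib ac_simps vadd_self_left)
  have l_inj: "l c = l d \<longleftrightarrow> c = d" for c d
    using w by (simp add: l_def)
  \<comment> \<open>Two points of the line differ by a multiple of the singular vector
    \<open>w\<close>, whereas \<open>f n = 1\<close>.\<close>
  have "l d \<noteq> l c + n" for c d
  proof
    assume "l d = l c + n"
    then have "n = l c + l d" by (simp add: vadd_self_left)
    then have "f ((c + d) *s w) = 1" using l_add f_n by metis
    then show False using w(2) unfolding f_scale by simp
  qed
  then have ov_inj: "ov (l c) = ov (l d) \<longleftrightarrow> c = d" for c d
    using ov_eq_iff[OF lA lA] l_inj by metis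
  have l_Int: "ov (l c) \<inter> ov (l d) = {pt w}" if "c \<noteq> d" for c d
    using ov_Int_collinear[OF lA lA _ lB, of c d] that l_inj l_add pt_scale[of "c + d" w]
    by (simp add: add_eq_0)
  have "O1 \<inter> O2 = {pt w}"
    if O: "O1 \<in> range (\<lambda>c. ov (l c))" "O2 \<in> range (\<lambda>c. ov (l c))" "O1 \<noteq> O2" for O1 O2
  proof -
    obtain c d where "O1 = ov (l c)" "O2 = ov (l d)" using O by blast
    with O(3) show ?thesis using l_Int[of c d] by blast
  qed
  moreover have "pt w \<in> Q0pts f H0" using w by (auto simp: Q0pts_eq)
  moreover have "card (range (\<lambda>c. ov (l c))) = CARD('a)"
    by (rule card_image) (simp add: inj_on_def ov_inj)
  moreover have "range (\<lambda>c. ov (l c)) \<subseteq> elliptic_ovoids f H0"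
    using lA ov_elliptic by blast
  ultimately have "rosette f H0 (pt w) (range (\<lambda>c. ov (l c)))"
    unfolding rosette_def by simp
  then show ?thesis by (simp add: l_def w_def)
qed

text \<open>The ovoids of \<open>x, y\<close> in a frame meet only in \<open>x + y + n\<close>, which is not on the ovoid
  of a third member.\<close>

lemma frame_nonlinear:
  assumes Y: "Y \<in> frames k" and k: "k \<ge> 3"
  shows "ov ` Y \<in> nonlinear_cliques f H0 k"
proof -
  have YA: "Y \<subseteq> A" and cY: "card Y = k" using Y by (auto simp: frames_def)
  have inj: "inj_on ov Y" by (rule frame_ov_inj[OF Y k])
  have "tangent (ov x) (ov y)" if "x \<in> Y" "y \<in> Y" "ov x \<noteq> ov y" for x y
  proof -
    have "B x y = 1" using Y that by (auto simp: frames_def)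
    then show ?thesis
      using that YA frame_no_antipodes[OF Y k that(1,2)] by (subst tangent_iff) auto
  qed
  then have "ov ` Y \<in> Gamma_cliques f H0 k"
    using YA ov_elliptic inj cY by (auto simp: Gamma_cliques_def card_image)
  moreover have "\<not> linear_clique f H0 (ov ` Y)"
  proof
    assume "linear_clique f H0 (ov ` Y)"
    then obtain p R where R: "rosette f H0 p R" "ov ` Y \<subseteq> R" by (auto simp: linear_clique_def)
    obtain Z where "Z \<subseteq> Y" "card Z = 3" using k cY by (metis obtain_subset_with_card_n)
    then obtain x y z where xyz: "x \<in> Y" "y \<in> Y" "z \<in> Y" "x \<noteq> y" "x \<noteq> z" "y \<noteq> z"
      by (auto simp: card_3_iff)
    have meet: "ov x' \<inter> ov y' = {p}" if "x' \<in> Y" "y' \<in> Y" "x' \<noteq> y'" for x' y'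
    proof -
      have "ov x' \<in> R" "ov y' \<in> R" "ov x' \<noteq> ov y'"
        using R(2) that inj_onD[OF inj, of x' y'] by auto
      then show ?thesis using R(1) unfolding rosette_def by blast
    qed
    have inA: "x \<in> A" "y \<in> A" "z \<in> A" using xyz YA by auto
    have B1: "B x y = 1" "B y z = 1" "B x z = 1" using Y xyz by (auto simp: frames_def)
    have ne: "x \<noteq> y + n" using frame_no_antipodes[OF Y k xyz(2,1)] .
    have "ov x \<inter> ov (y + n) = {pt (x + (y + n))}"
      by (rule ov_Int_collinear) (use inA A_antipode ne A_B_antipode[OF inA(1,2)] B1 in \<open>auto simp: two_eq_0\<close>)
    then have "pt (x + (y + n)) \<in> ov z"
      using meet[OF xyz(1,2,4)] meet[OF xyz(1,3,5)] by (auto simp: ov_antipode)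
    moreover have "x + (y + n) \<noteq> 0" using ne by (simp add: vadd_eq_0)
    ultimately have "B (x + (y + n)) z = 0" by (simp add: pt_in_ov)
    moreover have "B (x + (y + n)) z = 1"
      using inA B1 B_n_left[of z] by (simp add: B_add_left A_def two_eq_0)
    ultimately show False by simp
  qed
  ultimately show ?thesis by (simp add: nonlinear_cliques_def)
qed

text \<open>Replacing lifts by antipodes we may assume \<open>B y\<^sub>1 y = 1\<close> for all \<open>y\<close>. If then \<open>B y z = 0\<close>,
  the collinear triple \<open>y\<^sub>1 + n, y, z\<close> spans a line whose points have \<open>B\<close>-values in the prime field
  with any further member only if that member lies on the line as well.\<close>

lemma nonlinear_frame:
  assumes K: "K \<in> nonlinear_cliques f H0 k" and k: "k \<ge> 3"
  obtains Y where "Y \<in> frames k" "K = ov ` Y"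
proof -
  have Kc: "K \<subseteq> ov ` A" "card K = k"
    and tan: "\<And>O1 O2. O1 \<in> K \<Longrightarrow> O2 \<in> K \<Longrightarrow> O1 \<noteq> O2 \<Longrightarrow> tangent O1 O2"
    and nl: "\<not> linear_clique f H0 K"
    using K by (auto simp: nonlinear_cliques_def Gamma_cliques_def elliptic_ovoids_eq)
  obtain Y0 where Y0: "Y0 \<subseteq> A" "inj_on ov Y0" "K = ov ` Y0"
    using Kc(1) by (auto simp: subset_image_inj)
  then have "Y0 \<noteq> {}" using Kc(2) k by auto
  then obtain y1 where y1: "y1 \<in> Y0" by blast
  then have y1A: "y1 \<in> A" using Y0 by blast
  define g where "g y = (if y = y1 \<or> B y1 y = 1 then y else y + n)" for y
  define Y where "Y = g ` Y0"
  have ov_g: "ov (g y) = ov y" for y by (simp add: g_def ov_antipode)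
  have K_Y: "K = ov ` Y" by (simp add: Y0(3) Y_def image_image ov_g)
  have g1: "g y1 = y1" by (simp add: g_def)
  have YA: "Y \<subseteq> A" using Y0(1) A_antipode by (auto simp: Y_def g_def)
  have inj: "inj_on ov Y"
    using Y0(2) by (auto simp: Y_def inj_on_def ov_g)
  have cY: "card Y = k" using card_image[OF inj] K_Y Kc(2) by simp
  have y1Y: "y1 \<in> Y" using y1 g1 by (force simp: Y_def)
  have tanY: "y \<noteq> x + n" "B x y = 0 \<or> B x y = 1" if "x \<in> Y" "y \<in> Y" "x \<noteq> y" for x y
  proof -
    have "tangent (ov x) (ov y)"
      by (rule tan) (use K_Y that inj_onD[OF inj, of x y] in auto)
    then show "y \<noteq> x + n" "B x y = 0 \<or> B x y = 1"
      using that YA by (auto simp: tangent_iff subset_iff)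
  qed
  have B_y1: "B y1 y = 1" if y: "y \<in> Y" "y \<noteq> y1" for y
  proof -
    obtain y' where y': "y' \<in> Y0" "y = g y'" using y by (auto simp: Y_def)
    then have "y' \<noteq> y1" using y g1 by auto
    then have "ov y1 \<noteq> ov y'" using inj_onD[OF Y0(2)] y1 y' by blast
    then have "tangent (ov y1) (ov y')" using tan Y0(3) y1 y' by blast
    then have "B y1 y' = 0 \<or> B y1 y' = 1" using y1A y' Y0 by (auto simp: tangent_iff subset_iff)
    then show ?thesis
      using \<open>y' \<noteq> y1\<close> y'(2) A_B_antipode[OF y1A, of y'] y' Y0(1) by (auto simp: g_def)
  qed
  have "B y z = 1" if yz: "y \<in> Y" "z \<in> Y" "y \<noteq> z" "y \<noteq> y1" "z \<noteq> y1" for y z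
  proof (rule ccontr)
    assume "B y z \<noteq> 1"
    then have B0: "B y z = 0" using tanY yz by blast
    have A: "y \<in> A" "z \<in> A" "y1 + n \<in> A" using yz YA y1A A_antipode by auto
    let ?R = "range (\<lambda>c. ov (y + c *s (y + z)))"
    have on_line: "\<exists>c. v = y + c *s (y + z)" if v: "v \<in> A" "B v y = 0" "B v z = 0" for v
    proof -
      have "f v = 0" using v by (simp add: A_def)
      then obtain a b where ab: "v = a *s y + b *s z"
        using collinear_singular[OF A(1,2) yz(3) B0 _ v(2,3)] by blast
      then have "a + b = 1" using v A by (simp add: A_def form_simps)
      then have "a = 1 + b" by (metis add_self_left add.commute)
      then have "v = y + b *s (y + z)"
        using ab by (simp add: vec.scale_left_distrib vec.scale_right_distrib add.assoc)
      then show ?thesis by blast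
    qed
    have Bx: "B (y1 + n) y = 0" "B (y1 + n) z = 0"
      using A_B_antipode_left[OF y1A] A B_y1 yz by (auto simp: two_eq_0)
    obtain b where b: "y1 + n = y + b *s (y + z)" using on_line[OF A(3) Bx] by blast
    \<comment> \<open>The values 0 and 1 of \<open>b\<close> would put \<open>y1 + n\<close> at
      \<open>y\<close> or \<open>z\<close>, but distinct members of \<open>Y\<close> are never
      antipodal.\<close>
    have b0: "b \<noteq> 0"
    proof
      assume "b = 0"
      then have "y = y1 + n" using b by simp
      then show False using tanY(1)[OF y1Y yz(1)] yz(4) by auto
    qed
    have b1: "b \<noteq> 1"
    proof
      assume "b = 1"
      then have "z = y1 + n" using b by (simp add: vadd_self_left)
      then show False using tanY(1)[OF y1Y yz(2)] yz(5) by auto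
    qed
    have "ov v \<in> ?R" if v: "v \<in> Y" for v
    proof -
      consider "v = y1" | "v = y" | "v = z" | "v \<noteq> y1" "v \<noteq> y" "v \<noteq> z" by blast
      then have "\<exists>c. ov v = ov (y + c *s (y + z))"
      proof cases
        case 1
        then show ?thesis using b ov_antipode by metis
      next
        case 2
        then show ?thesis by (intro exI[of _ 0]) simp
      next
        case 3
        then show ?thesis by (intro exI[of _ 1]) (simp add: vadd_self_left)
      next
        case 4
        have vA: "v \<in> A" using v YA by blast
        have "B (y1 + n) v = 0"
          using A_B_antipode_left[OF y1A vA] B_y1[OF v 4(1)] by (simp add: two_eq_0)
        then have "B v (y + b *s (y + z)) = 0" using b B_sym by metis
        then have "B v y + b * (B v y + B v z) = 0" by (simp add: form_simps algebra_simps)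
        \<comment> \<open>The value pairs (1,0), (0,1) and (1,1) would turn the previous equation
          into \<open>1 + b = 0\<close>, \<open>b = 0\<close> and \<open>1 = 0\<close>, so both
          products vanish.\<close>
        moreover have "B v y = 0 \<or> B v y = 1" "B v z = 0 \<or> B v z = 1"
          using tanY(2) v yz 4 by blast+
        ultimately have "B v y = 0" "B v z = 0"
          using b0 b1 add_eq_0[of 1 b] by (auto simp: add_self two_eq_0)
        then show ?thesis using on_line[OF vA] by blast
      qed
      then show ?thesis by blast
    qed
    then have "K \<subseteq> ?R" using K_Y by blast
    then have "linear_clique f H0 K"
      unfolding linear_clique_def using line_rosette[OF A(1,2) yz(3) B0] by blast
    with nl show False by contradiction
  qed
  then have "B y z = 1" if "y \<in> Y" "z \<in> Y" "y \<noteq> z" for y z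
    using that B_y1 B_sym by metis
  then have "Y \<in> frames k" using YA cY by (auto simp: frames_def)
  then show thesis using K_Y that by blast
qed

text \<open>Both sides are parametrized by frames. Frames with the same ovoids differ only by
  antipodes, since each fibre of \<open>ov\<close> is an antipodal pair, and so have the same
  cover.\<close>

lemma phi0_bij:
  assumes k: "k \<ge> 3"
  shows "bij_betw ((`) (phi0 f H0)) (centric_configs f H0 k) (nonlinear_cliques f H0 k)"
  unfolding bij_betw_def
proof
  have cover_mono: "cover Y \<subseteq> cover Z" if Y: "Y \<in> frames k" and Z: "Z \<in> frames k" and eq: "ov ` Y = ov ` Z" for Y Z
  proof -
    have "y \<in> Z \<union> (\<lambda>y. y + n) ` Z" "y + n \<in> Z \<union> (\<lambda>y. y + n) ` Z" if y: "y \<in> Y" for y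
    proof -
      obtain z where z: "z \<in> Z" "ov z = ov y" using eq y by (metis imageE imageI)
      then have "y = z \<or> y = z + n" using y Y Z ov_eq_iff[of z y] by (auto simp: frames_def)
      then show "y \<in> Z \<union> (\<lambda>y. y + n) ` Z" "y + n \<in> Z \<union> (\<lambda>y. y + n) ` Z"
        using z by (auto simp: add.assoc vadd_self)
    qed
    then show ?thesis unfolding cover_def by (intro image_mono) auto
  qed
  show "inj_on ((`) (phi0 f H0)) (centric_configs f H0 k)"
    unfolding centric_configs_eq[OF k]
  proof (rule inj_onI)
    fix C D assume "C \<in> cover ` frames k" "D \<in> cover ` frames k" "phi0 f H0 ` C = phi0 f H0 ` D"
    then obtain Y Z where "Y \<in> frames k" "Z \<in> frames k" "C = cover Y" "D = cover Z" "ov ` Y = ov ` Z"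
      by (auto simp: phi0_cover)
    then show "C = D" using cover_mono[of Y Z] cover_mono[of Z Y] by simp
  qed
  have "nonlinear_cliques f H0 k = (`) ov ` frames k"
    using frame_nonlinear nonlinear_frame k by blast
  then show "(`) (phi0 f H0) ` centric_configs f H0 k = nonlinear_cliques f H0 k"
    by (simp add: centric_configs_eq[OF k] image_image phi0_cover)
qed

text \<open>The antipode of \<open>p\<close> is the only point at distance at least 3 from \<open>p\<close>, so it is determined by
  the collinearity graph.\<close>

lemma nucleus_join_Xadj:
  assumes "p \<in> Xpts f H0" "q \<in> Xpts f H0"
  shows "nucleus f H0 \<subseteq> vec.span (p \<union> q) \<longleftrightarrow>
    p \<noteq> q \<and> \<not> Xadj f H0 p q \<and> \<not> (\<exists>r\<in>Xpts f H0. Xadj f H0 p r \<and> Xadj f H0 r q)"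
proof -
  obtain x y where xy: "x \<in> A" "y \<in> A" "p = pt x" "q = pt y" using assms by (auto simp: Xpts_eq)
  have "y = x + n \<longleftrightarrow> x \<noteq> y \<and> B x y \<noteq> 0 \<and> \<not> (\<exists>z\<in>A. x \<noteq> z \<and> B x z = 0 \<and> z \<noteq> y \<and> B z y = 0)"
  proof
    assume y: "y = x + n"
    have "B z y = B x z + 1" if "z \<in> A" for z
      using A_B_antipode[OF that xy(1)] y B_sym[of z x] by simp
    moreover from this[OF xy(1)] have "B x y = 1" by simp
    ultimately show "x \<noteq> y \<and> B x y \<noteq> 0 \<and> \<not> (\<exists>z\<in>A. x \<noteq> z \<and> B x z = 0 \<and> z \<noteq> y \<and> B z y = 0)"
      using xy(1) y n_nonzero by auto
  next
    assume far: "x \<noteq> y \<and> B x y \<noteq> 0 \<and> \<not> (\<exists>z\<in>A. x \<noteq> z \<and> B x z = 0 \<and> z \<noteq> y \<and> B z y = 0)"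
    show "y = x + n"
    proof (rule ccontr)
      assume "y \<noteq> x + n"
      then have "\<not> ov x \<subseteq> ov y" using ov_subset_imp[OF xy(1,2)] far by blast
      then obtain P where P: "P \<in> ov x" "P \<notin> ov y" by blast
      then obtain v where v: "P = pt v" "v \<noteq> 0" "f v = 0" "B v n = 0" "B v x = 0" by (auto simp: ov_eq)
      with P(2) have vy: "B v y \<noteq> 0" by (simp add: pt_in_ov)
      \<comment> \<open>The line through \<open>x\<close> and the point \<open>P\<close> of its
        ovoid carries this point, whose coefficient makes it orthogonal to \<open>y\<close>: a
        common neighbour of \<open>x\<close> and \<open>y\<close>.\<close>
      define z where "z = x + (B x y / B v y) *s v"
      have "z \<in> A" "B x z = 0" "B z y = 0"
        using xy v vy B_sym[of x v] by (auto simp: z_def A_def form_simps)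
      moreover have "x \<noteq> z" "z \<noteq> y" using \<open>B z y = 0\<close> \<open>B x z = 0\<close> far by auto
      ultimately show False using far by blast
    qed
  qed
  moreover have "pt x = pt y \<longleftrightarrow> x = y" using pt_eqD xy by blast
  ultimately show ?thesis
    using xy by (simp add: nucleus_join_iff Xadj_iff Xpts_eq) blast
qed

section \<open>Transport along automorphisms\<close>

lemma config_image:
  assumes inj: "inj_on g (Xpts f H0)" and im: "\<And>p. p \<in> Xpts f H0 \<Longrightarrow> g p \<in> Xpts f H0"
    and adj: "\<And>p q. p \<in> Xpts f H0 \<Longrightarrow> q \<in> Xpts f H0 \<Longrightarrow> Xadj f H0 (g p) (g q) \<longleftrightarrow> Xadj f H0 p q"
    and anti: "\<And>p q. p \<in> Xpts f H0 \<Longrightarrow> q \<in> Xpts f H0 \<Longrightarrow>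
      nucleus f H0 \<subseteq> vec.span (g p \<union> g q) \<longleftrightarrow> nucleus f H0 \<subseteq> vec.span (p \<union> q)"
    and C: "C \<in> centric_configs f H0 k"
  shows "g ` C \<in> centric_configs f H0 k"
proof -
  obtain x where x: "inj_on (\<lambda>(i, a). x i a) ({1..k} \<times> {1, 2::nat})"
    and CX: "C = (\<lambda>(i, a). x i a) ` ({1..k} \<times> {1, 2})"
    and X: "\<forall>i\<in>{1..k}. \<forall>a\<in>{1, 2}. x i a \<in> Xpts f H0"
    and adj': "\<forall>i\<in>{1..k}. \<forall>a\<in>{1,2}. \<forall>j\<in>{1..k}. \<forall>b\<in>{1,2}.
          Xadj f H0 (x i a) (x j b) \<longleftrightarrow> i \<noteq> j \<and> a \<noteq> b"
    and anti': "\<forall>i\<in>{1..k}. nucleus f H0 \<subseteq> vec.span (x i 1 \<union> x i 2)"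
    using C unfolding centric_configs_def by blast
  have sub: "C \<subseteq> Xpts f H0" using X by (auto simp: CX)
  show ?thesis
    unfolding centric_configs_def
  proof (intro CollectI exI[of _ "\<lambda>i a. g (x i a)"] conjI)
    have "inj_on (g \<circ> (\<lambda>(i, a). x i a)) ({1..k} \<times> {1, 2})"
      using x inj_on_subset[OF inj sub] by (intro comp_inj_on) (auto simp: CX)
    then show "inj_on (\<lambda>(i, a). g (x i a)) ({1..k} \<times> {1, 2})"
      by (simp add: comp_def case_prod_unfold)
    show "g ` C = (\<lambda>(i, a). g (x i a)) ` ({1..k} \<times> {1, 2})"
      by (simp add: CX image_image case_prod_unfold)
  qed (use X adj adj' anti anti' im in \<open>simp_all\<close>)
qed

text \<open>By \<open>nucleus_join_Xadj\<close> the nucleus condition depends on adjacency alone, so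
  both \<open>\<alpha>\<close> and its inverse satisfy the premises of
  \<open>config_image\<close>.\<close>

lemma automorphism_bij:
  assumes aut: "X_automorphism f H0 \<alpha>"
  shows "bij_betw ((`) \<alpha>) (centric_configs f H0 k) (centric_configs f H0 k)"
proof -
  let ?X = "Xpts f H0"
  have bij: "bij_betw \<alpha> ?X ?X" and lines: "\<And>L. L \<subseteq> ?X \<Longrightarrow> L \<in> Xlines f H0 \<longleftrightarrow> \<alpha> ` L \<in> Xlines f H0"
    using aut by (auto simp: X_automorphism_def)
  have inj: "inj_on \<alpha> ?X" and im: "\<alpha> ` ?X = ?X" using bij by (auto simp: bij_betw_def)
  have imE: "\<alpha> p \<in> ?X" if "p \<in> ?X" for p using im that by blast
  have lines_sub: "L \<subseteq> ?X" if "L \<in> Xlines f H0" for L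
    using that by (auto simp: Xlines_def Xpts_def)
  have adj: "Xadj f H0 (\<alpha> p) (\<alpha> q) \<longleftrightarrow> Xadj f H0 p q" if pq: "p \<in> ?X" "q \<in> ?X" for p q
  proof
    assume "Xadj f H0 p q"
    then obtain L where L: "p \<noteq> q" "L \<in> Xlines f H0" "p \<in> L" "q \<in> L" by (auto simp: Xadj_def)
    then have "\<alpha> ` L \<in> Xlines f H0" using lines lines_sub by blast
    then show "Xadj f H0 (\<alpha> p) (\<alpha> q)"
      unfolding Xadj_def using L inj_on_eq_iff[OF inj pq] by (intro conjI bexI[of _ "\<alpha> ` L"]) auto
  next
    assume "Xadj f H0 (\<alpha> p) (\<alpha> q)"
    then obtain L where L: "\<alpha> p \<noteq> \<alpha> q" "L \<in> Xlines f H0" "\<alpha> p \<in> L" "\<alpha> q \<in> L" by (auto simp: Xadj_def)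
    have "L \<subseteq> \<alpha> ` ?X" using im lines_sub[OF L(2)] by simp
    \<comment> \<open>Surjectivity exhibits the line as an image, so the equivalence in
      \<open>X_automorphism\<close> turns its preimage into a line.\<close>
    then have "\<alpha> ` {r \<in> ?X. \<alpha> r \<in> L} = L" by blast
    then have "{r \<in> ?X. \<alpha> r \<in> L} \<in> Xlines f H0" using lines[of "{r \<in> ?X. \<alpha> r \<in> L}"] L(2) by auto
    then show "Xadj f H0 p q"
      unfolding Xadj_def using L pq by (intro conjI bexI[of _ "{r \<in> ?X. \<alpha> r \<in> L}"]) auto
  qed
  have anti: "nucleus f H0 \<subseteq> vec.span (\<alpha> p \<union> \<alpha> q) \<longleftrightarrow> nucleus f H0 \<subseteq> vec.span (p \<union> q)"
    if pq: "p \<in> ?X" "q \<in> ?X" for p q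
  proof -
    have "(\<exists>r\<in>?X. Xadj f H0 (\<alpha> p) r \<and> Xadj f H0 r (\<alpha> q)) \<longleftrightarrow>
        (\<exists>r\<in>\<alpha> ` ?X. Xadj f H0 (\<alpha> p) r \<and> Xadj f H0 r (\<alpha> q))"
      by (simp only: im)
    also have "\<dots> \<longleftrightarrow> (\<exists>r\<in>?X. Xadj f H0 p r \<and> Xadj f H0 r q)"
      using adj pq by auto
    finally show ?thesis
      using pq adj[OF pq] imE inj_on_eq_iff[OF inj pq] by (simp add: nucleus_join_Xadj)
  qed
  have sub: "C \<subseteq> ?X" if "C \<in> centric_configs f H0 k" for C
    using that by (fastforce simp: centric_configs_def)
  define \<beta> where "\<beta> = inv_into ?X \<alpha>"
  have \<beta>X: "\<beta> p \<in> ?X" and \<alpha>\<beta>: "\<alpha> (\<beta> p) = p" if "p \<in> ?X" for p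
    using that im by (auto simp: \<beta>_def inv_into_into f_inv_into_f)
  have \<beta>\<alpha>: "\<beta> (\<alpha> p) = p" if "p \<in> ?X" for p using that inj by (simp add: \<beta>_def)
  show ?thesis
  proof (rule bij_betw_byWitness[where f' = "(`) \<beta>"])
    show "\<forall>C\<in>centric_configs f H0 k. \<beta> ` \<alpha> ` C = C"
    proof
      fix C assume "C \<in> centric_configs f H0 k"
      then have "\<beta> ` \<alpha> ` C = (\<lambda>p. p) ` C"
        unfolding image_image using sub \<beta>\<alpha> by (intro image_cong) auto
      then show "\<beta> ` \<alpha> ` C = C" by simp
    qed
    show "\<forall>C\<in>centric_configs f H0 k. \<alpha> ` \<beta> ` C = C"
    proof
      fix C assume "C \<in> centric_configs f H0 k"
      then have "\<alpha> ` \<beta> ` C = (\<lambda>p. p) ` C"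
        unfolding image_image using sub \<alpha>\<beta> by (intro image_cong) auto
      then show "\<alpha> ` \<beta> ` C = C" by simp
    qed
    show "(`) \<alpha> ` centric_configs f H0 k \<subseteq> centric_configs f H0 k"
      using config_image[OF inj imE adj anti] by blast
    have "inj_on \<beta> ?X" using \<alpha>\<beta> by (metis inj_onI)
    moreover have "Xadj f H0 (\<beta> p) (\<beta> q) \<longleftrightarrow> Xadj f H0 p q" if "p \<in> ?X" "q \<in> ?X" for p q
      using adj[OF \<beta>X \<beta>X, OF that] \<alpha>\<beta> that by simp
    moreover have "nucleus f H0 \<subseteq> vec.span (\<beta> p \<union> \<beta> q) \<longleftrightarrow> nucleus f H0 \<subseteq> vec.span (p \<union> q)"
      if "p \<in> ?X" "q \<in> ?X" for p q
      using anti[OF \<beta>X \<beta>X, OF that] \<alpha>\<beta> that by simp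
    ultimately show "(`) \<beta> ` centric_configs f H0 k \<subseteq> centric_configs f H0 k"
      using config_image[of \<beta>] \<beta>X by blast
  qed
qed

lemma phi_bij:
  assumes "X_automorphism f H0 \<alpha>" "k \<ge> 3"
  shows "bij_betw (\<lambda>S. (phi0 f H0 \<circ> \<alpha>) ` S) (centric_configs f H0 k) (nonlinear_cliques f H0 k)"
  using bij_betw_trans[OF automorphism_bij[OF assms(1)] phi0_bij[OF assms(2)]]
  by (simp add: comp_def image_image)

end

theorem theorem3:
  fixes f :: "'a::{field,finite} ^ 6 \<Rightarrow> 'a"
    and H0 :: "('a ^ 6) set"
    and n :: nat
    and \<alpha> :: "'a pt \<Rightarrow> 'a pt"
  assumes q: "CARD('a) = 2 ^ n"
    and qf: "quadratic_form f"
    and nondeg: "nondeg_on f UNIV"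
    and witt: "witt_index_on f UNIV 2"
    and H0: "vec.subspace H0" "vec.dim H0 = 5"
    and parabolic: "nondeg_on f H0"
    and aut: "X_automorphism f H0 \<alpha>"
  shows "bij_betw (\<lambda>S. (phi0 f H0 \<circ> \<alpha>) ` S) (centric_configs f H0 3) (nonlinear_cliques f H0 3) \<and>
         bij_betw (\<lambda>S. (phi0 f H0 \<circ> \<alpha>) ` S) (centric_configs f H0 4) (nonlinear_cliques f H0 4) \<and>
         bij_betw (\<lambda>S. (phi0 f H0 \<circ> \<alpha>) ` S) (centric_configs f H0 6) (nonlinear_cliques f H0 6)"
proof -
  interpret char2_form f
    using qf two_eq_0_if_card_power_2[OF q] by unfold_locales
  \<comment> \<open>Even dimension rules out a nonsingular radical vector, so the polar form itself
    has trivial radical.\<close>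
  have "even (vec.dim (UNIV :: ('a ^ 6) set))" by (simp add: card_cart_basis)
  then have nd: "r = 0" if "\<And>w. polar f r w = 0" for r
    using even_dim_nondegenerate[of UNIV r] nondeg that by auto
  \<comment> \<open>Here \<open>m\<close> is the nucleus vector called \<open>n\<close> in the
    locale, as \<open>n\<close> is now the exponent of the field order.\<close>
  obtain m where m: "f m = 1" "H0 = {w. polar f m w = 0}" "nucleus f H0 = vec.span {m}"
    using nucleus_vector[OF nd H0 parabolic] .
  interpret nucleus_form f H0 m
    by unfold_locales (fact nd witt m)+
  show ?thesis using phi_bij[OF aut] by simp
qed

end
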